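(* Let $\mathbb{D}=\{z\in\mathbb{C}:|z|<1\}$, let $p$ be analytic in $\mathbb{D}$ with $p(0)=1$, let $\beta$ be a real number, and suppose that $1+\beta z p'(z)\prec\sqrt{1+z}$. Then the following hold: (a) If $\beta\ge \dfrac{2(\sqrt{2}-1+\log 2-\log(1+\sqrt{2}))}{\sqrt{2}-1}$, then $p(z)\prec\sqrt{1+z}$. (b) If $\beta\ge \dfrac{2(1-\log 2)}{3-2\sqrt{2}}$, then $p(z)\prec\varphi_0(z)$, where $\varphi_0(z)=1+\frac{z}{k}\cdot\frac{k+z}{k-z}$ with $k=\sqrt{2}+1$. (c) If $\beta\ge \dfrac{2(1-\log 2)}{\sin(1)}$, then $p(z)\prec 1+\sin z$. (d) If $\beta\ge (2+\sqrt{2})(1-\log 2)$, then $p(z)\prec z+\sqrt{1+z^2}$. (e) If $\beta\ge 3(1-\log 2)$, then $p(z)\prec 1+\frac{4}{3}z+\frac{2}{3}z^2$. (f) Let $-1<B<A<1$ and $$B_0=\frac{2-\log 4-\sqrt{2}+\log(1+\sqrt{2})}{\sqrt{2}-\log(1+\sqrt{2})}.$$ If either (i) $B<B_0$ and $\beta\ge \dfrac{2(1-B)(1-\log 2)}{A-B}$, or (ii) $B>B_0$ and $\beta\ge \dfrac{2(1+B)(\sqrt{2}-1+\log 2-\log(1+\sqrt{2}))}{A-B}$, then $p(z)\prec \dfrac{1+Az}{1+Bz}$. Moreover, the bounds on $\beta$ are sharp: in each of (a)–(e), and in each of (f)(i) and (f)(ii) for fixed admissible $A,B$, the stated lower bound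 on $\beta$ cannot be replaced by any smaller number (for the class of all such $p$).
   Context: For analytic functions $f,g$ on $\mathbb{D}$, $f$ is subordinate to $g$, written $f\prec g$ or $f(z)\prec g(z)$, if there is an analytic function $w:\mathbb{D}\to\mathbb{D}$ with $w(0)=0$ such that $f=g\circ w$. Square roots denote the analytic branches on $\mathbb{D}$ taking the value $1$ at $z=0$ (principal branches), and $\log$ of a positive real number is the natural logarithm. *)

theory Defs
  imports "HOL-Complex_Analysis.Complex_Analysis"
begin

abbreviation unit_disc :: "complex set" ("\<D>") where
  "\<D> \<equiv> ball 0 1"

definition subordinate :: "(complex \<Rightarrow> complex) \<Rightarrow> (complex \<Rightarrow> complex) \<Rightarrow> bool"  (infix "\<prec>\<^sub>\<D>" 50) where
  "f \<prec>\<^sub>\<D> g \<longleftrightarrow>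
     f analytic_on \<D> \<and> g analytic_on \<D> \<and>
     (\<exists>w. w analytic_on \<D> \<and> w \<in> \<D> \<rightarrow> \<D> \<and> w 0 = 0 \<and> (\<forall>z\<in>\<D>. f z = g (w z)))"

text \<open>The principal square root \<^const>\<open>csqrt\<close> is the required analytic branch here, since
  \<open>1 + z\<close> (and likewise \<open>1 + z\<^sup>2\<close>) has positive real part on the unit disc.\<close>

definition subord_class :: "real \<Rightarrow> (complex \<Rightarrow> complex) set" where
  "subord_class \<beta> = {p. p analytic_on \<D> \<and> p 0 = 1 \<and>
     (\<lambda>z. 1 + of_real \<beta> * z * deriv p z) \<prec>\<^sub>\<D> (\<lambda>z. csqrt (1 + z))}"

definition phi0 :: "complex \<Rightarrow> complex" where
  "phi0 z = (let k = of_real (sqrt 2 + 1) in 1 + z / k * ((k + z) / (k - z)))"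

definition B0 :: real where
  "B0 = (2 - ln 4 - sqrt 2 + ln (1 + sqrt 2)) / (sqrt 2 - ln (1 + sqrt 2))"

text \<open>\<open>b\<close> cannot be lowered in the assertion ``for all \<open>\<beta> \<ge> b\<close>, every \<open>p\<close> in the class for \<open>\<beta>\<close>
  is subordinate to \<open>\<phi>\<close>''. The number \<open>\<beta>\<close> ranges over a half-line rather than being fixed,
  because a single \<open>\<beta>\<close> below the bound need not fail: large negative \<open>\<beta>\<close> force the
  subordination as well.\<close>

definition sharp_bound :: "(complex \<Rightarrow> complex) \<Rightarrow> real \<Rightarrow> bool" where
  "sharp_bound \<phi> b \<longleftrightarrow> (\<forall>b'<b. \<not> (\<forall>\<beta>\<ge>b'. \<forall>p\<in>subord_class \<beta>. p \<prec>\<^sub>\<D> \<phi>))"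

end

theory Submission
  imports Defs
begin

text \<open>
  With \<open>P = \<beta> (p - 1)\<close> the hypothesis reads \<open>z P'(z) = csqrt (1 + w(z)) - 1\<close> where
  \<open>|w(z)| \<le> |z|\<close> by the Schwarz lemma, and the extremal case \<open>w(z) = z\<close> has an elementary
  solution \<open>q\<close>. For each direction \<open>u\<close> a maximum principle bounds \<open>Re (cnj u * P)\<close> by the integral
  over \<open>r\<close> of \<open>m(r) / r\<close>, where \<open>m(r)\<close> is the extent along the ray through \<open>u\<close> of the image of
  the disc of radius \<open>r\<close> under \<open>csqrt (1 + z) - 1\<close>. Replacing \<open>m(r)\<close> by simple upper bounds
  gives what is needed: \<open>m(r) \<le> 1 - sqrt (1 - r)\<close> yields \<open>|P| < - q(-1)\<close>, which settles (b)-(e);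
  the linear interpolation in \<open>Re u\<close> between the values at \<open>u = 1\<close> and \<open>u = -1\<close> puts the image
  of \<open>P\<close> into the disc with diameter \<open>[q(-1), q(1)]\<close>, which settles (f); and for \<open>Re u \<ge> 0\<close> the
  interpolation between \<open>u = 1\<close> and the crude bound \<open>r / 2\<close> suffices for the lemniscate in (a).
  Sharpness is seen from \<open>p = 1 + q / \<beta>\<close> at real points near \<open>1\<close> or \<open>-1\<close>.
\<close>

section \<open>A support function bound\<close>

lemma has_real_derivative_Re_mult:
  assumes "(f has_vector_derivative f') (at t within S)"
  shows "((\<lambda>t. Re (c * f t)) has_real_derivative Re (c * f')) (at t within S)"
  unfolding has_real_derivative_iff_has_vector_derivative
  by (rule bounded_linear.has_vector_derivative[OF _ assms])
     (intro bounded_linear_compose[OF bounded_linear_Re bounded_linear_mult_right])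

text \<open>Squaring gives \<open>\<omega> = m * u * (2 + m * u)\<close>. The principal root has
  nonnegative real part, so \<open>2 + m * u\<close> has real part at least 1; this yields the crude
  bound \<open>m \<le> r\<close>.\<close>

lemma csqrt_minus_one_radius:
  fixes \<omega> u :: complex and m r :: real
  assumes eq: "csqrt (1 + \<omega>) - 1 = of_real m * u" and u: "norm u = 1"
    and \<omega>: "norm \<omega> \<le> r" and m: "m > 0"
  shows "m \<le> r" "m * norm (2 + of_real m * u) \<le> r"
proof -
  have s: "csqrt (1 + \<omega>) = 1 + of_real m * u"
    using eq by (simp add: algebra_simps)
  have "1 + \<omega> = (1 + of_real m * u)\<^sup>2"
    unfolding s[symmetric] by simp
  then have "\<omega> = of_real m * u * (2 + of_real m * u)"
    by (simp add: power2_eq_square algebra_simps)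
  then have n: "norm \<omega> = m * norm (2 + of_real m * u)"
    using u m by (simp add: norm_mult)
  then show *: "m * norm (2 + of_real m * u) \<le> r"
    using \<omega> by simp
  have "Re (1 + of_real m * u) \<ge> 0"
    unfolding s[symmetric] by (rule Re_csqrt)
  then have "Re (2 + of_real m * u) \<ge> 1"
    by simp
  then have "norm (2 + of_real m * u) \<ge> 1"
    using complex_Re_le_cmod order_trans by blast
  then have "m * 1 \<le> m * norm (2 + of_real m * u)"
    using m by (intro mult_left_mono) auto
  then show "m \<le> r" using * by simp
qed

text \<open>At a maximum \<open>z\<close> of \<open>Re (cnj u * P) - F \<circ> norm\<close> over a closed disc the tangential
  derivative vanishes, so \<open>z * deriv P z\<close> points in the direction \<open>u\<close>; hence only the extent
  of \<open>csqrt (1 + \<omega>) - 1\<close> along the ray through \<open>u\<close> has to be controlled, and not its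
  (larger) extent with respect to the half-planes orthogonal to \<open>u\<close>.\<close>

lemma support_bound:
  fixes P :: "complex \<Rightarrow> complex" and F F' :: "real \<Rightarrow> real"
  assumes hol: "P holomorphic_on \<D>" and P0: "P 0 = 0"
    and P': "\<And>z. z \<in> \<D> \<Longrightarrow> \<exists>\<omega>. norm \<omega> \<le> norm z \<and> z * deriv P z = csqrt (1 + \<omega>) - 1"
    and u: "norm u = 1"
    and F0: "F 0 = 0" and contF: "continuous_on {0..1} F"
    and F': "\<And>r. 0 < r \<Longrightarrow> r < 1 \<Longrightarrow> (F has_real_derivative F' r) (at r)"
    and radius: "\<And>r m. 0 < r \<Longrightarrow> r < 1 \<Longrightarrow> 0 < m \<Longrightarrow> m \<le> r \<Longrightarrow>
        m * norm (2 + of_real m * u) \<le> r \<Longrightarrow> m \<le> r * F' r"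
    and z: "z \<in> \<D>"
  shows "Re (cnj u * P z) < F 1"
proof -
  have u1: "u * cnj u = 1" "cnj u * u = 1"
    using u complex_norm_square[of u] by (simp_all add: mult.commute)
  \<comment> \<open>Positivity of \<open>F'\<close> comes from \<open>radius\<close> itself:
    \<open>m = r / 3\<close> is always admissible, because \<open>norm (2 + m * u)\<close> is then
    at most 3.\<close>
  have F'pos: "F' r > 0" if r: "0 < r" "r < 1" for r
  proof -
    have "norm (2 + of_real (r / 3) * u) \<le> norm (2::complex) + norm (of_real (r / 3) * u)"
      by (rule norm_triangle_ineq)
    also have "\<dots> \<le> 3" using r u by (simp add: norm_mult)
    finally have "r / 3 * norm (2 + of_real (r / 3) * u) \<le> r / 3 * 3"
      using r by (intro mult_left_mono) auto
    then have "r / 3 \<le> r * F' r"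
      using r by (intro radius) auto
    then have "0 < r * F' r" using r by linarith
    then show ?thesis using r by (simp add: zero_less_mult_iff)
  qed
  have le: "Re (cnj u * P z) \<le> F (norm z)"
  proof (rule ccontr)
    assume "\<not> ?thesis"
    then have gt: "Re (cnj u * P z) - F (norm z) > 0" by simp
    then have z0: "z \<noteq> 0" using P0 F0 by auto
    \<comment> \<open>Half the excess: subtracting \<open>e * norm x\<close> leaves
      \<open>v z\<close> positive and makes the radial inequality at the maximum strict.\<close>
    define e where "e = (Re (cnj u * P z) - F (norm z)) / 2"
    have e: "e > 0" using gt by (simp add: e_def)
    define v where "v x = Re (cnj u * P x) - F (norm x) - e * norm x" for x
    have "e * norm z \<le> e * 1" using z e by (intro mult_left_mono) auto
    moreover have "Re (cnj u * P z) - F (norm z) = 2 * e" by (simp add: e_def)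
    ultimately have vz: "v z > 0" unfolding v_def using e by linarith
    have sub: "cball 0 (norm z) \<subseteq> \<D>" using z by auto
    have contP: "continuous_on (cball 0 (norm z)) P"
      using hol sub holomorphic_on_imp_continuous_on continuous_on_subset by blast
    have "continuous_on (cball 0 (norm z)) (\<lambda>x. F (norm x))"
      by (rule continuous_on_compose2[OF contF]) (use z in \<open>auto intro!: continuous_intros\<close>)
    then have "continuous_on (cball 0 (norm z)) v"
      unfolding v_def using contP by (intro continuous_intros) auto
    then obtain y where y: "y \<in> cball 0 (norm z)" and ymax: "\<And>x. x \<in> cball 0 (norm z) \<Longrightarrow> v x \<le> v y"
      using continuous_attains_sup[of "cball 0 (norm z)" v] by auto
    have "v y > 0" using ymax[of z] vz by auto
    then have y0: "y \<noteq> 0" using P0 F0 by (auto simp: v_def)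
    have yD: "y \<in> \<D>" using y sub by auto
    define r where "r = norm y"
    have r: "0 < r" "r < 1" using y0 yD by (auto simp: r_def)
    have derP: "(P has_field_derivative deriv P y) (at y)"
      using hol yD by (simp add: holomorphic_derivI)
    obtain \<omega> where \<omega>: "norm \<omega> \<le> r" "y * deriv P y = csqrt (1 + \<omega>) - 1"
      using P'[OF yD] r_def by auto
    define D where "D = cnj u * (y * deriv P y)"

    \<comment> \<open>Moving inward stays in the closed disc, so the radial derivative at the
      maximum is nonnegative even if \<open>y\<close> lies on the boundary circle.\<close>
    have radial: "Re D - r * F' r - e * r \<ge> 0"
    proof (rule ccontr)
      assume neg: "\<not> ?thesis"
      define g where "g t = Re (cnj u * P (of_real t * y)) - F (t * r) - e * (t * r)" for t :: real
      have "((\<lambda>t::complex. t * y) has_field_derivative y) (at 1)"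
        by (auto intro!: derivative_eq_intros)
      then have "((\<lambda>t. P (of_real t * y)) has_vector_derivative (y * deriv P y)) (at 1)"
        using DERIV_chain2[of P "deriv P y" "\<lambda>t. t * y" 1 y UNIV] derP
        by (intro has_vector_derivative_real_field) (simp add: mult.commute)
      then have a: "((\<lambda>t. Re (cnj u * P (of_real t * y))) has_real_derivative Re D) (at 1)"
        unfolding D_def by (rule has_real_derivative_Re_mult)
      have b: "((\<lambda>t. F (t * r)) has_real_derivative F' r * r) (at 1)"
        by (rule DERIV_chain2[of F]) (use F'[OF r] in \<open>auto intro!: derivative_eq_intros\<close>)
      have "(g has_real_derivative (Re D - F' r * r - e * r)) (at 1)"
        unfolding g_def by (rule derivative_eq_intros a b refl | simp)+
      from DERIV_neg_dec_left[OF this] neg obtain d where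
        d: "d > 0" "\<And>h. h > 0 \<Longrightarrow> h < d \<Longrightarrow> g 1 < g (1 - h)"
        by (auto simp: mult.commute)
      define t where "t = 1 - min (d/2) (1/2)"
      have t: "0 < t" "t < 1" using d by (auto simp: t_def)
      have "g 1 < g t" unfolding t_def using d by (intro d(2)) auto
      moreover have "g 1 = v y" by (simp add: g_def v_def r_def)
      moreover have "g t = v (of_real t * y)" using t by (simp add: g_def v_def r_def norm_mult)
      moreover have "of_real t * y \<in> cball 0 (norm z)"
        using t y mult_left_le_one_le[of "norm y" t] by (auto simp: norm_mult)
      ultimately show False using ymax by fastforce
    qed

    \<comment> \<open>Rotation leaves the norm fixed, so only \<open>P\<close> varies; the
      derivative along it is \<open>Re (\<i> * D) = - Im D\<close>.\<close>
    have tang: "Im D = 0"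
    proof -
      define g where "g t = Re (cnj u * P (exp (\<i> * of_real t) * y)) - F r - e * r" for t :: real
      have "((\<lambda>t. exp (\<i> * t) * y) has_field_derivative (\<i> * y)) (at 0)"
        by (auto intro!: derivative_eq_intros)
      then have "((\<lambda>t. P (exp (\<i> * of_real t) * y)) has_vector_derivative (\<i> * y * deriv P y)) (at 0)"
        using DERIV_chain2[of P "deriv P y" "\<lambda>t. exp (\<i> * t) * y" 0 "\<i> * y" UNIV] derP
        by (intro has_vector_derivative_real_field) (simp add: mult_ac)
      then have a: "((\<lambda>t. Re (cnj u * P (exp (\<i> * of_real t) * y))) has_real_derivative
          Re (cnj u * (\<i> * y * deriv P y))) (at 0)"
        by (rule has_real_derivative_Re_mult)
      have "(g has_real_derivative Re (cnj u * (\<i> * y * deriv P y))) (at 0)"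
        unfolding g_def by (rule derivative_eq_intros a refl | simp)+
      moreover have "g t \<le> g 0" for t
      proof -
        have n: "norm (exp (\<i> * of_real t) * y) = norm y"
          by (simp add: norm_mult)
        then have "exp (\<i> * of_real t) * y \<in> cball 0 (norm z)" using y by simp
        from ymax[OF this] show ?thesis unfolding v_def n by (simp add: g_def r_def)
      qed
      ultimately have "Re (cnj u * (\<i> * y * deriv P y)) = 0"
        using DERIV_local_max[of g _ 0 1] by auto
      moreover have "cnj u * (\<i> * y * deriv P y) = \<i> * D" by (simp add: D_def)
      ultimately show ?thesis by simp
    qed
    define m where "m = Re D"
    have "m > r * F' r" using radial e r mult_pos_pos[of e r] unfolding m_def by linarith
    moreover have "m > 0" using calculation F'pos[OF r] r by (simp add: order.strict_trans[rotated])
    moreover have "D = of_real m" using tang by (simp add: m_def complex_eq_iff)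
    then have "csqrt (1 + \<omega>) - 1 = of_real m * u"
      using u1 \<omega>(2) unfolding D_def by (metis mult.assoc mult.commute mult.left_neutral)
    ultimately show False
      using csqrt_minus_one_radius[of \<omega> m u r] u \<omega>(1) radius[OF r, of m] by fastforce
  qed
  also have "F (norm z) < F 1"
  proof (rule DERIV_pos_imp_increasing_open[of "norm z" 1 F])
    show "norm z < 1" using z by simp
    show "continuous_on {norm z..1} F"
      using contF by (rule continuous_on_subset) auto
    show "\<exists>y. (F has_real_derivative y) (at x) \<and> 0 < y" if "norm z < x" "x < 1" for x
      using F'[of x] F'pos[of x] that norm_ge_zero[of z] by fastforce
  qed
  finally show ?thesis .
qed

section \<open>Radial bounds for the image of the square root\<close>

text \<open>The solution of \<open>x * q'(x) = sqrt (1 + x) - 1\<close> with \<open>q 0 = 0\<close>.\<close>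

definition dominant_real :: "real \<Rightarrow> real" where
  "dominant_real x = 2 * (sqrt (1 + x) - 1 - ln ((1 + sqrt (1 + x)) / 2))"

lemma dominant_real_0 [simp]: "dominant_real 0 = 0"
  by (simp add: dominant_real_def)

lemma dominant_real_1: "dominant_real 1 = 2 * (sqrt 2 - 1 + ln 2 - ln (1 + sqrt 2))"
proof -
  have "1 + sqrt 2 > 0" by (simp add: add_pos_nonneg)
  then show ?thesis by (simp add: dominant_real_def ln_div)
qed

lemma dominant_real_minus_1: "dominant_real (-1) = - (2 * (1 - ln 2))"
  by (simp add: dominant_real_def ln_div)

text \<open>The quotient \<open>(sqrt (1 + x) - 1) / x\<close> is kept in rationalised form, which
  makes \<open>x = 0\<close> an ordinary point.\<close>

lemma has_real_derivative_dominant_real: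
  assumes "x > -1"
  shows "(dominant_real has_real_derivative 1 / (1 + sqrt (1 + x))) (at x)"
proof -
  define s where "s = sqrt (1 + x)"
  have s: "s > 0" using assms by (simp add: s_def)
  have sq: "((\<lambda>x. sqrt (1 + x)) has_real_derivative 1 / (2 * s)) (at x)"
    using assms by (auto intro!: derivative_eq_intros simp: s_def field_simps)
  have "((\<lambda>x. (1 + sqrt (1 + x)) / 2) has_real_derivative 1 / (2 * s) / 2) (at x)"
    by (rule DERIV_cdivide, rule DERIV_cong, rule DERIV_add[OF DERIV_const sq]) simp
  then have "((\<lambda>x. ln ((1 + sqrt (1 + x)) / 2)) has_real_derivative
      1 / ((1 + s) / 2) * (1 / (2 * s) / 2)) (at x)"
    unfolding s_def
    by (rule DERIV_chain2[rotated, OF _ DERIV_ln_divide]) (use s in \<open>simp add: s_def add_pos_pos\<close>)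
  then have "(dominant_real has_real_derivative
      2 * (1 / (2 * s) - 0 - 1 / ((1 + s) / 2) * (1 / (2 * s) / 2))) (at x)"
    unfolding dominant_real_def[abs_def]
    by (intro DERIV_cmult DERIV_diff sq DERIV_const)
  moreover have "2 * (1 / (2 * s) - 0 - 1 / ((1 + s) / 2) * (1 / (2 * s) / 2)) = 1 / (1 + s)"
    using s by (simp add: divide_simps)
  ultimately show ?thesis by (simp add: s_def)
qed

lemma continuous_on_dominant_real: "continuous_on {-1..} dominant_real"
proof -
  have "1 + sqrt (1 + x) \<noteq> 0" if "x \<ge> -1" for x :: real
    using real_sqrt_ge_zero[of "1 + x"] that by linarith
  then show ?thesis
    unfolding dominant_real_def[abs_def] by (intro continuous_intros) auto
qed

lemma mult_dominant_derivative:
  assumes "x \<ge> -1"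
  shows "x * (1 / (1 + sqrt (1 + x))) = sqrt (1 + x) - 1"
proof -
  have "(sqrt (1 + x) - 1) * (1 + sqrt (1 + x)) = x"
    using assms by (simp add: algebra_simps)
  moreover have "1 + sqrt (1 + x) > 0" using assms by (simp add: add_pos_nonneg)
  ultimately show ?thesis by (simp add: field_simps)
qed

lemma radius_square:
  fixes u :: complex and m :: real
  assumes "norm u = 1"
  shows "(m * norm (2 + of_real m * u))\<^sup>2 = m\<^sup>2 * (4 + 4 * m * Re u + m\<^sup>2)"
proof -
  have "(Re u)\<^sup>2 + (Im u)\<^sup>2 = 1" using assms cmod_power2[of u] by simp
  then have "(Im u)\<^sup>2 = 1 - (Re u)\<^sup>2" by simp
  then show ?thesis
    by (simp add: power_mult_distrib cmod_power2)
       (simp add: power2_eq_square algebra_simps)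
qed

text \<open>The worst direction is \<open>u = -1\<close>:
  \<open>norm (2 + m * u) \<ge> 2 - m\<close>, and completing the square in
  \<open>m * (2 - m) \<le> r\<close> gives the bound.\<close>

lemma radius_le_left:
  fixes u :: complex and m r :: real
  assumes u: "norm u = 1" and m: "0 < m" "m \<le> r" and r: "r < 1"
    and le: "m * norm (2 + of_real m * u) \<le> r"
  shows "m \<le> 1 - sqrt (1 - r)"
proof -
  have "2 - m \<le> norm (2 + of_real m * u)"
    using norm_diff_ineq[of 2 "of_real m * u"] u m by (simp add: norm_mult)
  then have "m * (2 - m) \<le> r"
    using le m mult_left_mono[of "2 - m" "norm (2 + of_real m * u)" m] by linarith
  then have "1 - r \<le> (1 - m)\<^sup>2" by (simp add: power2_eq_square algebra_simps)
  then have "sqrt (1 - r) \<le> 1 - m" using m r by (intro real_le_lsqrt) auto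
  then show ?thesis by simp
qed

text \<open>For \<open>Re u \<ge> 0\<close> the expression
  \<open>x^2 * (4 + 4 * x * Re u + x^2)\<close> increases in \<open>x > 0\<close>. It is at most
  \<open>r^2\<close> at \<open>m\<close>, so it suffices that it is at least \<open>r^2\<close> at
  the claimed bound \<open>L\<close>.\<close>

lemma radius_le_right:
  fixes u :: complex and m r :: real
  assumes u: "norm u = 1" "Re u \<ge> 0" and m: "0 < m" "m \<le> r" and r: "r < 1"
    and le: "m * norm (2 + of_real m * u) \<le> r"
  shows "m \<le> Re u * (sqrt (1 + r) - 1) + (1 - Re u) * (r / 2)"
proof -
  define g where "g = sqrt (1 + r) - 1"
  define d where "d = 1 - Re u"
  \<comment> \<open>With \<open>r = g * (g + 2)\<close> the crude bound \<open>r / 2\<close> is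
    \<open>g + g^2 / 2\<close>, so the interpolation has the factor \<open>g\<close>.\<close>
  define L where "L = g * (1 + d * g / 2)"
  have g: "g > 0" using m r by (simp add: g_def)
  have rg: "r = g * (g + 2)"
    using m by (simp add: g_def algebra_simps)
  have d: "0 \<le> d" "d \<le> 1" using u abs_Re_le_cmod[of u] by (auto simp: d_def)
  have L0: "L > 0" using g d by (simp add: L_def add_pos_nonneg)
  have eqL: "L = Re u * g + (1 - Re u) * (r / 2)"
    unfolding L_def rg d_def by (simp add: field_simps)
  have "r\<^sup>2 \<le> L\<^sup>2 * (4 + 4 * L * (1 - d) + L\<^sup>2)"
  proof -
    \<comment> \<open>Expanded in powers of \<open>g\<close>, the left side drops the terms of order
      three and four, which are nonnegative.\<close>
    have 1: "(g + 2)\<^sup>2 - 4 * g * d + 2 * d * g\<^sup>2 * (1 - d) \<le> 4 + 4 * L * (1 - d) + L\<^sup>2"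
    proof -
      have "4 + 4 * L * (1 - d) + L\<^sup>2 - ((g + 2)\<^sup>2 - 4 * g * d + 2 * d * g\<^sup>2 * (1 - d))
          = d * g ^ 3 + d\<^sup>2 * g ^ 4 / 4"
        by (simp add: L_def power2_eq_square power3_eq_cube power4_eq_xxxx field_simps)
      also have "\<dots> \<ge> 0" using g d by simp
      finally show ?thesis by simp
    qed
    have 2: "1 + d * g \<le> (1 + d * g / 2)\<^sup>2"
      using zero_le_power2[of "d * g"] by (simp add: power2_eq_square field_simps)
    have 3: "0 \<le> (g + 2)\<^sup>2 - 4 * g * d + 2 * d * g\<^sup>2 * (1 - d)"
    proof -
      have "4 * g * d \<le> 4 * g * 1" using g d by (intro mult_left_mono) auto
      moreover have "0 \<le> 2 * d * g\<^sup>2 * (1 - d)" using d by simp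
      moreover have "(g + 2)\<^sup>2 = g\<^sup>2 + 4 * g + 4" by (simp add: power2_eq_square algebra_simps)
      ultimately show ?thesis using zero_le_power2[of g] by linarith
    qed
    have "(g + 2)\<^sup>2 \<le> (1 + d * g) * ((g + 2)\<^sup>2 - 4 * g * d + 2 * d * g\<^sup>2 * (1 - d))"
    proof -
      have "(1 + d * g) * ((g + 2)\<^sup>2 - 4 * g * d + 2 * d * g\<^sup>2 * (1 - d)) - (g + 2)\<^sup>2
          = d * g ^ 3 + 6 * d * g\<^sup>2 * (1 - d) + 2 * d\<^sup>2 * g ^ 3 * (1 - d)"
        by (simp add: power2_eq_square power3_eq_cube algebra_simps)
      also have "\<dots> \<ge> 0" using g d by simp
      finally show ?thesis by simp
    qed
    also have "\<dots> \<le> (1 + d * g / 2)\<^sup>2 * (4 + 4 * L * (1 - d) + L\<^sup>2)"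
      using 1 2 3 by (intro mult_mono) auto
    finally have "g\<^sup>2 * (g + 2)\<^sup>2 \<le> g\<^sup>2 * ((1 + d * g / 2)\<^sup>2 * (4 + 4 * L * (1 - d) + L\<^sup>2))"
      by (rule mult_left_mono) simp
    moreover have "r\<^sup>2 = g\<^sup>2 * (g + 2)\<^sup>2"
      by (simp only: rg power_mult_distrib)
    moreover have "L\<^sup>2 * (4 + 4 * L * (1 - d) + L\<^sup>2)
        = g\<^sup>2 * ((1 + d * g / 2)\<^sup>2 * (4 + 4 * L * (1 - d) + L\<^sup>2))"
      unfolding L_def power_mult_distrib by (simp only: mult.assoc)
    ultimately show ?thesis by (simp only:)
  qed
  moreover have "m\<^sup>2 * (4 + 4 * m * (1 - d) + m\<^sup>2) \<le> r\<^sup>2"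
    using power_mono[OF le, of 2] m radius_square[OF u(1), of m] by (simp add: d_def)
  moreover have "L\<^sup>2 * (4 + 4 * L * (1 - d) + L\<^sup>2) < m\<^sup>2 * (4 + 4 * m * (1 - d) + m\<^sup>2)" if "L < m"
  proof (rule mult_strict_mono)
    show "L\<^sup>2 < m\<^sup>2" using that L0 by (intro power_strict_mono) auto
    have "L * (1 - d) \<le> m * (1 - d)" using that d by (intro mult_right_mono) auto
    then show "4 + 4 * L * (1 - d) + L\<^sup>2 < 4 + 4 * m * (1 - d) + m\<^sup>2"
      using \<open>L\<^sup>2 < m\<^sup>2\<close> by simp
    show "0 < m\<^sup>2" using m by simp
    show "0 \<le> 4 + 4 * L * (1 - d) + L\<^sup>2" using L0 d by simp
  qed
  ultimately have "m \<le> L" by force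
  then show ?thesis by (simp add: eqL g_def)
qed

text \<open>The equation of the curve \<open>m * norm (2 + m * u) = r\<close> expresses \<open>Re u\<close> as a convex decreasing
  function of \<open>m\<close>, so conversely \<open>m\<close> lies below the chord as a function of \<open>Re u\<close>.\<close>

lemma radius_le_chord:
  fixes u :: complex and m r :: real
  assumes u: "norm u = 1" and m: "0 < m" "m \<le> r" and r: "r < 1"
    and le: "m * norm (2 + of_real m * u) \<le> r"
  shows "m \<le> (1 + Re u) / 2 * (sqrt (1 + r) - 1) + (1 - Re u) / 2 * (1 - sqrt (1 - r))"
proof -
  define g where "g = sqrt (1 + r) - 1"
  define k where "k = 1 - sqrt (1 - r)"
  \<comment> \<open>\<open>c x\<close> is the value of \<open>Re u\<close> for which
    \<open>x * norm (2 + x * u) = r\<close>; it is 1 at \<open>g\<close> and -1 at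
    \<open>k\<close>.\<close>
  define c where "c x = r\<^sup>2 / (4 * x ^ 3) - 1 / x - x / 4" for x
  have g: "g > 0" using m r by (simp add: g_def)
  have rg: "r = g * (g + 2)" using m by (simp add: g_def algebra_simps)
  have rk: "r = k * (2 - k)" using r by (simp add: k_def algebra_simps)
  have k1: "k \<le> 1" using r by (simp add: k_def)
  have mk: "m \<le> k" using radius_le_left[OF u m r le] by (simp add: k_def)
  have kr: "k \<le> r"
  proof -
    have "k * 1 \<le> k * (2 - k)" using k1 mk m by (intro mult_left_mono) auto
    then show ?thesis using rk by simp
  qed
  have gk: "g \<le> k"
  proof (rule ccontr)
    assume "\<not> ?thesis"
    then have "k * (2 - k) < g * (g + 2)" using mk m k1
      by (intro mult_strict_mono) auto
    then show False using rg rk by simp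
  qed
  have C: "-1 \<le> Re u" "Re u \<le> 1" using u abs_Re_le_cmod[of u] by auto
  have eq: "(1 + Re u) / 2 * g + (1 - Re u) / 2 * k = g + (1 - Re u) / 2 * (k - g)"
    by (simp add: field_simps)
  have "m \<le> g + (1 - Re u) / 2 * (k - g)"
  proof (cases "m \<le> g")
    case True
    then show ?thesis using C gk by (simp add: add_increasing2)
  next
    case False
    \<comment> \<open>The second derivative is \<open>(3 * r^2 - 2 * x^2) / x^5\<close>, nonnegative
      because \<open>x \<le> k \<le> r\<close>.\<close>
    have conv: "convex_on {g..k} c"
    proof (rule f''_ge0_imp_convex)
      fix x assume x: "x \<in> {g..k}"
      then have x0: "x > 0" using g by auto
      show "(c has_real_derivative (- 3 * r\<^sup>2 / (4 * x ^ 4) + 1 / x\<^sup>2 - 1 / 4)) (at x)"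
        unfolding c_def using x0
        by (auto intro!: derivative_eq_intros simp: field_simps power_numeral_reduce)
      show "((\<lambda>x. - 3 * r\<^sup>2 / (4 * x ^ 4) + 1 / x\<^sup>2 - 1 / 4) has_real_derivative
          (3 * r\<^sup>2 / x ^ 5 - 2 / x ^ 3)) (at x)"
        using x0
        by (auto intro!: derivative_eq_intros simp: field_simps power_numeral_reduce)
      have "x\<^sup>2 \<le> r\<^sup>2" using x x0 kr by (intro power_mono) auto
      then have "2 * x\<^sup>2 \<le> 3 * r\<^sup>2" by (smt (verit) zero_le_power2)
      moreover have "3 * r\<^sup>2 / x ^ 5 - 2 / x ^ 3 = (3 * r\<^sup>2 - 2 * x\<^sup>2) / x ^ 5"
        using x0 by (simp add: field_simps power_numeral_reduce)
      ultimately show "0 \<le> 3 * r\<^sup>2 / x ^ 5 - 2 / x ^ 3" using x0 by simp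
    qed simp
    have cg: "c g = 1" and ck: "c k = -1"
      unfolding c_def using g gk by (subst rg rk, simp add: field_simps power_numeral_reduce)+
    define l where "l = (m - g) / (k - g)"
    have kg: "k - g > 0" using False mk by simp
    have lm: "m = g + l * (k - g)" using kg by (simp add: l_def)
    have l: "0 \<le> l" "l \<le> 1"
      using kg False mk by (simp_all add: l_def)
    have lm': "m = (1 - l) * g + l * k"
      by (rule trans[OF lm]) (simp add: algebra_simps)
    have "c ((1 - l) *\<^sub>R g + l *\<^sub>R k) \<le> (1 - l) * c g + l * c k"
      by (rule convex_onD[OF conv]) (use l gk in auto)
    then have "c m \<le> 1 - 2 * l" unfolding cg ck lm' by simp
    moreover have "Re u \<le> c m"
    proof -
      have "m\<^sup>2 * (4 + 4 * m * Re u + m\<^sup>2) \<le> r\<^sup>2"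
        using power_mono[OF le, of 2] m radius_square[OF u(1), of m] by simp
      then have "4 * m ^ 3 * Re u \<le> r\<^sup>2 - 4 * m\<^sup>2 - m ^ 4"
        by (simp add: power2_eq_square power3_eq_cube power4_eq_xxxx algebra_simps)
      moreover have "c m * (4 * m ^ 3) = r\<^sup>2 - 4 * m\<^sup>2 - m ^ 4"
        using m by (simp add: c_def field_simps power_numeral_reduce)
      ultimately have "Re u * (4 * m ^ 3) \<le> c m * (4 * m ^ 3)" by (simp add: mult.commute)
      then show ?thesis using m by (simp add: mult_le_cancel_right)
    qed
    ultimately have "l \<le> (1 - Re u) / 2" by simp
    then have "l * (k - g) \<le> (1 - Re u) / 2 * (k - g)" using kg by (intro mult_right_mono) auto
    then show ?thesis using lm by simp
  qed
  then have "m \<le> (1 + Re u) / 2 * g + (1 - Re u) / 2 * k" by (simp only: eq)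
  then show ?thesis by (simp only: g_def k_def)
qed

section \<open>Bounds for the class\<close>

text \<open>With \<open>u = sgn V\<close>, a half-plane bound in the direction \<open>u\<close>
  becomes a bound on \<open>norm V\<close>.\<close>

lemma Re_cnj_sgn_mult: "Re (cnj (sgn z) * z) = norm z"
proof (cases "z = 0")
  case False
  have "cnj (sgn z) * z = of_real (norm z)"
    using False complex_norm_square[of z]
    by (simp add: sgn_div_norm scaleR_conv_of_real field_simps power2_eq_square)
  then show ?thesis by simp
qed simp

lemma subord_class_holomorphic:
  "p \<in> subord_class \<beta> \<Longrightarrow> p holomorphic_on \<D>"
  by (simp add: subord_class_def analytic_on_open)

text \<open>The Schwarz lemma, applied to the subordinating function, supplies the
  \<open>\<omega>\<close> that \<open>support_bound\<close> asks for.\<close>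

lemma subord_class_support_bound:
  fixes F F' :: "real \<Rightarrow> real"
  assumes p: "p \<in> subord_class \<beta>" and u: "norm u = 1"
    and F0: "F 0 = 0" and contF: "continuous_on {0..1} F"
    and F': "\<And>r. 0 < r \<Longrightarrow> r < 1 \<Longrightarrow> (F has_real_derivative F' r) (at r)"
    and radius: "\<And>r m. 0 < r \<Longrightarrow> r < 1 \<Longrightarrow> 0 < m \<Longrightarrow> m \<le> r \<Longrightarrow>
        m * norm (2 + of_real m * u) \<le> r \<Longrightarrow> m \<le> r * F' r"
    and z: "z \<in> \<D>"
  shows "Re (cnj u * (of_real \<beta> * (p z - 1))) < F 1"
proof (rule support_bound[OF _ _ _ u F0 contF F' radius z])
  have hol: "p holomorphic_on \<D>" using p by (rule subord_class_holomorphic)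
  then show "(\<lambda>z. of_real \<beta> * (p z - 1)) holomorphic_on \<D>"
    by (intro holomorphic_intros)
  show "of_real \<beta> * (p 0 - 1) = 0" using p by (simp add: subord_class_def)
  obtain w where w: "w holomorphic_on \<D>" "w \<in> \<D> \<rightarrow> \<D>" "w 0 = 0"
    and eq: "\<And>z. z \<in> \<D> \<Longrightarrow> 1 + of_real \<beta> * z * deriv p z = csqrt (1 + w z)"
    using p unfolding subord_class_def subordinate_def by (auto simp: analytic_on_open)
  fix z assume z: "z \<in> \<D>"
  have "norm (w z) \<le> norm z"
    using Schwarz_Lemma(1)[of w z] w z by (auto simp: Pi_iff)
  moreover have "deriv (\<lambda>z. of_real \<beta> * (p z - 1)) z = of_real \<beta> * deriv p z"
    by (rule DERIV_imp_deriv)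
       (use holomorphic_derivI[OF hol _ z] in \<open>auto intro!: derivative_eq_intros\<close>)
  ultimately show "\<exists>\<omega>. norm \<omega> \<le> norm z \<and>
      z * deriv (\<lambda>z. of_real \<beta> * (p z - 1)) z = csqrt (1 + \<omega>) - 1"
    using eq[OF z] by (intro exI[of _ "w z"]) (simp add: algebra_simps)
qed auto

lemma continuous_on_dominant_real_unit:
  "continuous_on {0..1} dominant_real" "continuous_on {0..1} (\<lambda>r. dominant_real (- r))"
  by (rule continuous_on_subset[OF continuous_on_dominant_real],  force)
     (rule continuous_on_compose2[OF continuous_on_dominant_real], auto intro!: continuous_intros)

lemma has_real_derivative_dominant_real_minus:
  assumes "r < 1"
  shows "((\<lambda>r. dominant_real (- r)) has_real_derivative - (1 / (1 + sqrt (1 - r)))) (at r)"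
proof -
  have "((\<lambda>r. dominant_real (- r)) has_real_derivative (1 / (1 + sqrt (1 + - r))) * (-1)) (at r)"
    by (rule DERIV_chain2[OF has_real_derivative_dominant_real])
       (use assms in \<open>auto intro!: derivative_eq_intros\<close>)
  then show ?thesis by simp
qed

lemma subord_class_norm_bound:
  assumes p: "p \<in> subord_class \<beta>" and z: "z \<in> \<D>"
  shows "norm (of_real \<beta> * (p z - 1)) < 2 * (1 - ln 2)"
proof -
  define V where "V = of_real \<beta> * (p z - 1)"
  \<comment> \<open>The default 1 at \<open>V = 0\<close> keeps \<open>u\<close> on the unit
    circle.\<close>
  define u where "u = (if V = 0 then 1 else sgn V)"
  have u: "norm u = 1" by (simp add: u_def norm_sgn)
  have "Re (cnj u * V) < - dominant_real (- 1)"
    unfolding V_def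
  proof (rule subord_class_support_bound[OF p u _ _ _ _ z])
    show "- dominant_real (- 0) = 0" by simp
    show "continuous_on {0..1} (\<lambda>r. - dominant_real (- r))"
      by (intro continuous_intros continuous_on_dominant_real_unit)
    show "((\<lambda>r. - dominant_real (- r)) has_real_derivative 1 / (1 + sqrt (1 - r))) (at r)"
      if "0 < r" "r < 1" for r
      using DERIV_minus[OF has_real_derivative_dominant_real_minus[OF that(2)]] by simp
    show "m \<le> r * (1 / (1 + sqrt (1 - r)))"
      if "0 < r" "r < 1" "0 < m" "m \<le> r" "m * norm (2 + of_real m * u) \<le> r" for r m
      using radius_le_left[OF u that(3,4,2,5)] mult_dominant_derivative[of "-r"] that by simp
  qed
  moreover have "Re (cnj u * V) = norm V"
    by (simp add: u_def Re_cnj_sgn_mult[of V] del: times_complex.simps)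
  ultimately show ?thesis
    unfolding V_def dominant_real_minus_1 by linarith
qed

text \<open>Integrates \<open>radius_le_right\<close> divided by \<open>r\<close>; the crude part
  \<open>r / 2\<close> contributes \<open>(1 - Re u) / 2\<close>.\<close>

lemma subord_class_right_bound:
  assumes p: "p \<in> subord_class \<beta>" and z: "z \<in> \<D>" and u: "norm u = 1" "Re u \<ge> 0"
  shows "Re (cnj u * (of_real \<beta> * (p z - 1))) < Re u * dominant_real 1 + (1 - Re u) / 2"
proof -
  have "Re (cnj u * (of_real \<beta> * (p z - 1))) < Re u * dominant_real 1 + (1 - Re u) * (1 / 2)"
  proof (rule subord_class_support_bound[OF p u(1) _ _ _ _ z,
        where F = "\<lambda>r. Re u * dominant_real r + (1 - Re u) * (r / 2)"])
    show "Re u * dominant_real 0 + (1 - Re u) * (0 / 2) = 0" by simp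
    show "continuous_on {0..1} (\<lambda>r. Re u * dominant_real r + (1 - Re u) * (r / 2))"
      by (intro continuous_intros continuous_on_dominant_real_unit) auto
    show "((\<lambda>r. Re u * dominant_real r + (1 - Re u) * (r / 2)) has_real_derivative
        Re u * (1 / (1 + sqrt (1 + r))) + (1 - Re u) / 2) (at r)" if "0 < r" "r < 1" for r
      using that
      by (auto intro!: derivative_eq_intros DERIV_cong[OF has_real_derivative_dominant_real])
    show "m \<le> r * (Re u * (1 / (1 + sqrt (1 + r))) + (1 - Re u) / 2)"
      if "0 < r" "r < 1" "0 < m" "m \<le> r" "m * norm (2 + of_real m * u) \<le> r" for r m
    proof -
      have "r * (Re u * (1 / (1 + sqrt (1 + r))) + (1 - Re u) / 2)
          = Re u * (r * (1 / (1 + sqrt (1 + r)))) + (1 - Re u) * (r / 2)"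
        by (simp add: algebra_simps)
      also have "r * (1 / (1 + sqrt (1 + r))) = sqrt (1 + r) - 1"
        using that by (intro mult_dominant_derivative) auto
      finally show ?thesis using radius_le_right[OF u that(3,4,2,5)] by simp
    qed
  qed
  then show ?thesis by simp
qed

text \<open>The bound is affine in \<open>Re u\<close>, hence the support function of a disc: centre
  \<open>(X - Y) / 2\<close> and radius \<open>(X + Y) / 2\<close> with
  \<open>X = dominant_real 1\<close> and \<open>Y = 2 * (1 - ln 2)\<close>.\<close>

lemma subord_class_chord_bound:
  assumes p: "p \<in> subord_class \<beta>" and z: "z \<in> \<D>" and u: "norm u = 1"
  shows "Re (cnj u * (of_real \<beta> * (p z - 1)))
    < (1 + Re u) / 2 * dominant_real 1 + (1 - Re u) / 2 * (2 * (1 - ln 2))"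
proof -
  have "Re (cnj u * (of_real \<beta> * (p z - 1)))
    < (1 + Re u) / 2 * dominant_real 1 - (1 - Re u) / 2 * dominant_real (- 1)"
  proof (rule subord_class_support_bound[OF p u _ _ _ _ z,
        where F = "\<lambda>r. (1 + Re u) / 2 * dominant_real r - (1 - Re u) / 2 * dominant_real (- r)"])
    show "(1 + Re u) / 2 * dominant_real 0 - (1 - Re u) / 2 * dominant_real (- 0) = 0" by simp
    show "continuous_on {0..1} (\<lambda>r. (1 + Re u) / 2 * dominant_real r - (1 - Re u) / 2 * dominant_real (- r))"
      by (intro continuous_intros continuous_on_dominant_real_unit)
    show "((\<lambda>r. (1 + Re u) / 2 * dominant_real r - (1 - Re u) / 2 * dominant_real (- r))
        has_real_derivative (1 + Re u) / 2 * (1 / (1 + sqrt (1 + r)))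
          + (1 - Re u) / 2 * (1 / (1 + sqrt (1 - r)))) (at r)" if "0 < r" "r < 1" for r
      using DERIV_diff[OF DERIV_cmult[OF has_real_derivative_dominant_real[of r], of "(1 + Re u) / 2"]
          DERIV_cmult[OF has_real_derivative_dominant_real_minus[of r], of "(1 - Re u) / 2"]] that
      by (simp only: mult_minus_right diff_minus_eq_add)
    show "m \<le> r * ((1 + Re u) / 2 * (1 / (1 + sqrt (1 + r))) + (1 - Re u) / 2 * (1 / (1 + sqrt (1 - r))))"
      if "0 < r" "r < 1" "0 < m" "m \<le> r" "m * norm (2 + of_real m * u) \<le> r" for r m
    proof -
      have "r * ((1 + Re u) / 2 * (1 / (1 + sqrt (1 + r))) + (1 - Re u) / 2 * (1 / (1 + sqrt (1 - r))))
          = (1 + Re u) / 2 * (r * (1 / (1 + sqrt (1 + r)))) + (1 - Re u) / 2 * (r * (1 / (1 + sqrt (1 - r))))"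
        by (simp only: distrib_left mult.left_commute)
      also have "r * (1 / (1 + sqrt (1 + r))) = sqrt (1 + r) - 1"
        using that by (intro mult_dominant_derivative) auto
      also have "r * (1 / (1 + sqrt (1 - r))) = 1 - sqrt (1 - r)"
        using mult_dominant_derivative[of "-r"] that by simp
      finally show ?thesis using radius_le_chord[OF u that(3,4,2,5)] by simp
    qed
  qed
  then show ?thesis
    by (simp only: dominant_real_minus_1 mult_minus_right diff_minus_eq_add)
qed

section \<open>Targets containing a disc about 1\<close>

text \<open>On the connected disc \<open>norm (w z)\<close> is continuous and starts at 0, so it
  cannot pass 1 without attaining it. A candidate inverse thus only has to avoid the unit
  circle.\<close>

lemma subordinateI:
  assumes "p holomorphic_on \<D>" "\<phi> holomorphic_on \<D>" "w holomorphic_on \<D>" and w0: "w 0 = 0"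
    and eq: "\<And>z. z \<in> \<D> \<Longrightarrow> p z = \<phi> (w z)" and ne: "\<And>z. z \<in> \<D> \<Longrightarrow> norm (w z) \<noteq> 1"
  shows "p \<prec>\<^sub>\<D> \<phi>"
proof -
  have "norm (w z) < 1" if z: "z \<in> \<D>" for z
  proof (rule ccontr)
    assume "\<not> ?thesis"
    then have ge: "1 \<le> norm (w z)" by simp
    have "connected ((\<lambda>z. norm (w z)) ` \<D>)"
      using assms(3) holomorphic_on_imp_continuous_on
      by (intro connected_continuous_image continuous_intros) (auto simp: convex_connected)
    moreover have "0 \<in> (\<lambda>z. norm (w z)) ` \<D>" using w0 by (intro image_eqI[of _ _ 0]) auto
    moreover have "norm (w z) \<in> (\<lambda>z. norm (w z)) ` \<D>" using z by blast
    ultimately have "1 \<in> (\<lambda>z. norm (w z)) ` \<D>"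
      using ge connectedD_interval zero_le_one by blast
    then show False using ne by (metis (no_types, lifting) imageE)
  qed
  then show ?thesis
    unfolding subordinate_def using assms by (auto simp: analytic_on_open intro!: exI[of _ w])
qed

text \<open>For (b)-(e) this is applied with \<open>s = 1 - \<phi> (-1)\<close>, where
  \<open>\<phi>\<close> is the target; each target then only has to contain the disc of radius
  \<open>s\<close> about 1.\<close>

lemma subord_class_norm_less:
  assumes p: "p \<in> subord_class \<beta>" and z: "z \<in> \<D>" and s: "s > 0"
    and \<beta>: "\<beta> \<ge> 2 * (1 - ln 2) / s"
  shows "norm (p z - 1) < s"
proof -
  have "\<beta> * norm (p z - 1) \<le> \<bar>\<beta>\<bar> * norm (p z - 1)" by (intro mult_right_mono) auto
  also have "\<dots> < 2 * (1 - ln 2)"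
    using subord_class_norm_bound[OF p z] by (simp add: norm_mult)
  also have "\<dots> \<le> \<beta> * s" using \<beta> s by (simp add: field_simps)
  finally have lt: "\<beta> * norm (p z - 1) < \<beta> * s" .
  have "(0::real) < 2 * (1 - ln 2) / s" using s ln_2_less_1 by simp
  then have "\<beta> > 0" using \<beta> by linarith
  then show ?thesis using lt by simp
qed

section \<open>Subordination to the individual targets of (b)-(e)\<close>

lemma one_plus_in_disc_nonpos_Reals:
  "norm (z::complex) < 1 \<Longrightarrow> 1 + z \<notin> \<real>\<^sub>\<le>\<^sub>0"
  using abs_Re_le_cmod[of z] by (auto simp: complex_nonpos_Reals_iff)

lemma sqrt_two_bounds: "1414 / 1000 < sqrt 2" "sqrt 2 < 1415 / 1000"
  by (rule real_less_rsqrt real_less_lsqrt; simp add: power2_eq_square)+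

lemma phi0_altdef:
  "phi0 z = 1 + z * (of_real (sqrt 2 + 1) + z) / (of_real (sqrt 2 + 1) * (of_real (sqrt 2 + 1) - z))"
  by (simp add: phi0_def Let_def)

lemma sqrt2_plus_one_minus_nonzero: "norm z \<le> 1 \<Longrightarrow> of_real (sqrt 2 + 1) - (z::complex) \<noteq> 0"
proof
  assume z: "norm z \<le> 1" and "of_real (sqrt 2 + 1) - z = 0"
  then have "z = of_real (sqrt 2 + 1)" by simp
  then have "norm z = sqrt 2 + 1" by (metis norm_of_real abs_of_pos add_pos_pos real_sqrt_gt_zero zero_less_numeral zero_less_one)
  then show False using z sqrt_two_bounds by simp
qed

lemma phi0_holomorphic: "phi0 holomorphic_on \<D>"
proof -
  have k: "complex_of_real (sqrt 2 + 1) \<noteq> 0"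
    using sqrt_two_bounds by (simp only: of_real_eq_0_iff)
  show ?thesis unfolding phi0_altdef[abs_def]
    using k sqrt2_plus_one_minus_nonzero by (intro holomorphic_intros) (auto simp del: of_real_add)
qed

text \<open>The equation \<open>phi0 w = 1 + Y\<close> is quadratic in \<open>w\<close>, with discriminant
  \<open>k\<^sup>2 * (1 + 6 * Y + Y\<^sup>2)\<close>.\<close>

lemma subordinate_phi0:
  assumes p: "p holomorphic_on \<D>" "p 0 = 1"
    and lt: "\<And>z. z \<in> \<D> \<Longrightarrow> norm (p z - 1) < 3 - 2 * sqrt 2"
  shows "p \<prec>\<^sub>\<D> phi0"
proof -
  \<comment> \<open>\<open>-r\<close> and \<open>-R\<close> are the roots of
    \<open>Y^2 + 6 * Y + 1\<close>. Splitting the root of the discriminant over them keeps both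
    radicands in the right half-plane, since \<open>norm (p z - 1) < r\<close>.\<close>
  define k r R :: complex where "k = of_real (sqrt 2 + 1)"
    and "r = of_real (3 - 2 * sqrt 2)" and "R = of_real (3 + 2 * sqrt 2)"
  define q where "q z = csqrt (p z - 1 + r) * csqrt (p z - 1 + R)" for z
  define w where "w z = k / 2 * (q z - p z)" for z
  have k0: "k \<noteq> 0"
    using sqrt_two_bounds by (simp only: k_def of_real_eq_0_iff)
  have rR: "r * R = 1" "r + R = 6"
    by (simp_all add: r_def R_def algebra_simps flip: of_real_mult)
  have nonpos: "p z - 1 + r \<notin> \<real>\<^sub>\<le>\<^sub>0" "p z - 1 + R \<notin> \<real>\<^sub>\<le>\<^sub>0" if "z \<in> \<D>" for z
    using lt[OF that] abs_Re_le_cmod[of "p z - 1"] sqrt_two_bounds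
    by (auto simp: complex_nonpos_Reals_iff r_def R_def)
  have root: "(w z)\<^sup>2 + k * p z * w z - k\<^sup>2 * (p z - 1) = 0" for z
  proof -
    have "(q z)\<^sup>2 = (p z - 1 + r) * (p z - 1 + R)"
      by (simp add: q_def power_mult_distrib)
    also have "\<dots> = (p z)\<^sup>2 + 4 * (p z - 1)"
      using rR by algebra
    finally have "(q z)\<^sup>2 = (p z)\<^sup>2 + 4 * (p z - 1)" .
    moreover have "2 * w z = k * (q z - p z)" by (simp add: w_def)
    ultimately have "4 * ((w z)\<^sup>2 + k * p z * w z - k\<^sup>2 * (p z - 1)) = 0"
      by algebra
    then show ?thesis by (metis mult_eq_0_iff zero_neq_numeral)
  qed
  \<comment> \<open>The pole of \<open>phi0\<close> is no root of the cleared equation: at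
    \<open>w = k\<close> its left side equals \<open>2 * k^2\<close>.\<close>
  have wk: "k - w z \<noteq> 0" for z
  proof
    assume "k - w z = 0"
    then have "2 * k\<^sup>2 = 0" using root[of z] by algebra
    then show False using k0 by simp
  qed
  have eq: "p z = phi0 (w z)" for z
  proof -
    have "(p z - 1) * (k * (k - w z)) = w z * (k + w z)"
      using root[of z] by algebra
    then have "p z - 1 = w z * (k + w z) / (k * (k - w z))"
      using wk[of z] k0 by (simp add: nonzero_eq_divide_eq)
    then show ?thesis unfolding phi0_altdef k_def[symmetric] by (simp only: diff_eq_eq add.commute)
  qed
  show ?thesis
  proof (rule subordinateI[where w = w])
    show "w holomorphic_on \<D>"
      unfolding w_def q_def using nonpos p by (intro holomorphic_intros) auto
    have "csqrt r * csqrt R = of_real (sqrt (3 - 2 * sqrt 2) * sqrt (3 + 2 * sqrt 2))"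
      unfolding r_def R_def using sqrt_two_bounds by (simp add: csqrt_of_real del: of_real_add of_real_diff)
    also have "sqrt (3 - 2 * sqrt 2) * sqrt (3 + 2 * sqrt 2) = 1"
      by (simp add: real_sqrt_mult[symmetric] algebra_simps)
    finally show "w 0 = 0" using p by (simp add: w_def q_def)
    fix z assume z: "z \<in> \<D>"
    show "p z = phi0 (w z)" by (rule eq)
    \<comment> \<open>On the unit circle \<open>norm (k + w)\<close> is at least
      \<open>k - 1\<close> and \<open>norm (k - w)\<close> at most \<open>k + 1\<close>, both
      attained at \<open>w = -1\<close>; so \<open>norm (phi0 w - 1)\<close> is at least
      \<open>3 - 2 * sqrt 2\<close> there.\<close>
    show "norm (w z) \<noteq> 1"
    proof
      assume w1: "norm (w z) = 1"
      have nk: "norm k = sqrt 2 + 1" using sqrt_two_bounds by (simp only: k_def norm_of_real)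
      have 1: "sqrt 2 \<le> norm (k + w z)" using norm_diff_ineq[of k "w z"] w1 nk by simp
      have 2: "norm (k - w z) \<le> sqrt 2 + 2" using norm_triangle_ineq4[of k "w z"] w1 nk by simp
      have "norm (p z - 1) * ((sqrt 2 + 1) * norm (k - w z)) = norm (k + w z)"
      proof -
        have "(p z - 1) * (k * (k - w z)) = w z * (k + w z)"
          using root[of z] by algebra
        from arg_cong[OF this, of norm] show ?thesis using w1 nk by (simp add: norm_mult)
      qed
      moreover have "norm (p z - 1) * ((sqrt 2 + 1) * norm (k - w z))
          < (3 - 2 * sqrt 2) * ((sqrt 2 + 1) * norm (k - w z))"
        using lt[OF z] wk[of z] sqrt_two_bounds by (intro mult_strict_right_mono mult_pos_pos) auto
      moreover have "(3 - 2 * sqrt 2) * ((sqrt 2 + 1) * norm (k - w z))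
          \<le> (3 - 2 * sqrt 2) * ((sqrt 2 + 1) * (sqrt 2 + 2))"
        using 2 sqrt_two_bounds by (intro mult_left_mono) auto
      moreover have "(3 - 2 * sqrt 2) * ((sqrt 2 + 1) * (sqrt 2 + 2)) = sqrt 2"
        by (simp add: algebra_simps)
      ultimately show False using 1 by linarith
    qed
  qed (use p phi0_holomorphic in auto)
qed

text \<open>\<open>2 * (norm (sin z))^2 = cosh (2 * y) - cos (2 * x)\<close>. With
  \<open>cosh (2 * y) \<ge> 1 + 2 * y^2\<close> and \<open>y^2 = 1 - x^2\<close> it remains that
  \<open>2 * x^2 + cos (2 * x)\<close> is largest at \<open>\<bar>x\<bar> = 1\<close>.\<close>

lemma sin_norm_one_lower_bound:
  fixes z :: complex
  assumes "norm z = 1"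
  shows "norm (sin z) \<ge> sin 1"
proof -
  define x y where "x = Re z" and "y = Im z"
  have xy: "x\<^sup>2 + y\<^sup>2 = 1" using assms cmod_power2[of z] by (simp add: x_def y_def)
  have "2 * \<bar>x\<bar>\<^sup>2 + cos (2 * \<bar>x\<bar>) \<le> 2 * 1\<^sup>2 + cos (2 * 1)"
  proof (rule DERIV_nonneg_imp_nondecreasing[where f = "\<lambda>t. 2 * t\<^sup>2 + cos (2 * t)"])
    show "\<bar>x\<bar> \<le> 1" using assms abs_Re_le_cmod[of z] by (simp add: x_def)
    fix t assume "\<bar>x\<bar> \<le> t" "t \<le> 1"
    then have t: "0 \<le> t" by linarith
    have "((\<lambda>t. 2 * t\<^sup>2 + cos (2 * t)) has_real_derivative 4 * t - 2 * sin (2 * t)) (at t)"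
      by (auto intro!: derivative_eq_intros)
    moreover have "sin (2 * t) \<le> 2 * t" using t by (intro sin_x_le_x) auto
    ultimately show "\<exists>d. ((\<lambda>t. 2 * t\<^sup>2 + cos (2 * t)) has_real_derivative d) (at t) \<and> 0 \<le> d"
      by (intro exI[of _ "4 * t - 2 * sin (2 * t)"]) auto
  qed
  moreover have "cos (2 * \<bar>x\<bar>) = cos (2 * x)" by (simp add: abs_if)
  ultimately have cosx: "2 * x\<^sup>2 + cos (2 * x) \<le> 2 + cos 2" by simp
  have "1 + 2 * y\<^sup>2 \<le> cosh (2 * y)"
  proof -
    have sq: "y\<^sup>2 \<le> (sinh y)\<^sup>2"
    proof -
      have "\<bar>y\<bar> \<le> sinh \<bar>y\<bar>"
      proof -
        have "sinh 0 - 0 \<le> sinh \<bar>y\<bar> - \<bar>y\<bar>"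
        proof (rule DERIV_nonneg_imp_nondecreasing[where f = "\<lambda>t. sinh t - t"])
          fix t :: real
          show "\<exists>d. ((\<lambda>t. sinh t - t) has_real_derivative d) (at t) \<and> 0 \<le> d"
            using cosh_real_ge_1[of t]
            by (intro exI[of _ "cosh t - 1"]) (auto intro!: derivative_eq_intros)
        qed simp
        then show ?thesis by simp
      qed
      then have "\<bar>y\<bar>\<^sup>2 \<le> (sinh \<bar>y\<bar>)\<^sup>2" by (intro power_mono) auto
      moreover have "(sinh \<bar>y\<bar>)\<^sup>2 = (sinh y)\<^sup>2" by (cases "y \<ge> 0") auto
      ultimately show ?thesis by (simp only: power2_abs)
    qed
    have "cosh (2 * y) = 1 + 2 * (sinh y)\<^sup>2"
      using cosh_add[of y y] cosh_square_eq[of y] by (simp add: power2_eq_square)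
    then show ?thesis using sq by simp
  qed
  moreover have "exp (2 * y) + inverse (exp (2 * y)) = 2 * cosh (2 * y)"
    by (simp add: cosh_def exp_minus)
  ultimately have "4 * (norm (sin z))\<^sup>2 \<ge> 2 * (1 + 2 * y\<^sup>2) - 2 * cos (2 * x)"
    by (simp add: norm_sin_squared x_def y_def)
  moreover have "cos 2 = 1 - 2 * (sin (1::real))\<^sup>2"
    using cos_double_sin[of 1] by simp
  ultimately have "(sin 1)\<^sup>2 \<le> (norm (sin z))\<^sup>2" using xy cosx by simp
  then show ?thesis by (rule power2_le_imp_le) simp
qed

lemma sin_one_pos: "0 < sin (1::real)"
  using pi_gt3 by (intro sin_gt_zero) auto

lemma sin_one_less_one: "sin (1::real) < 1"
  using sin_x_le_x[of 1] sin_monotone_2pi[of 1 "pi/2"] pi_gt3 by simp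

text \<open>Since \<open>sin 1 < 1\<close>, the values \<open>p z - 1\<close> stay in the unit disc,
  where \<open>Arcsin\<close> is holomorphic.\<close>

lemma subordinate_one_plus_sin:
  assumes p: "p holomorphic_on \<D>" "p 0 = 1"
    and lt: "\<And>z. z \<in> \<D> \<Longrightarrow> norm (p z - 1) < sin 1"
  shows "p \<prec>\<^sub>\<D> (\<lambda>z. 1 + sin z)"
proof (rule subordinateI[where w = "\<lambda>z. Arcsin (p z - 1)"])
  have "Arcsin holomorphic_on ball 0 1"
    using abs_Re_le_cmod le_less_trans by (intro holomorphic_on_Arcsin) fastforce
  moreover have "(\<lambda>z. p z - 1) holomorphic_on \<D>" using p by (intro holomorphic_intros)
  ultimately show "(\<lambda>z. Arcsin (p z - 1)) holomorphic_on \<D>"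
    using holomorphic_on_compose_gen[of "\<lambda>z. p z - 1" \<D> Arcsin "ball 0 1"] lt sin_one_less_one
    by (fastforce simp: o_def)
  show "norm (Arcsin (p z - 1)) \<noteq> 1" if "z \<in> \<D>" for z
    using sin_norm_one_lower_bound[of "Arcsin (p z - 1)"] lt[OF that] by auto
qed (use p in \<open>auto intro!: holomorphic_intros\<close>)

text \<open>The target is inverted by \<open>p \<mapsto> (p - 1 / p) / 2\<close>, because
  \<open>csqrt (1 + w^2)\<close> is then \<open>(p + 1 / p) / 2\<close>, of positive real
  part.\<close>

lemma subordinate_crescent:
  assumes p: "p holomorphic_on \<D>" "p 0 = 1"
    and lt: "\<And>z. z \<in> \<D> \<Longrightarrow> norm (p z - 1) < 2 - sqrt 2"
  shows "p \<prec>\<^sub>\<D> (\<lambda>z. z + csqrt (1 + z\<^sup>2))"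
proof (rule subordinateI[where w = "\<lambda>z. (p z - 1 / p z) / 2"])
  have Re: "Re (p z) > 0" if "z \<in> \<D>" for z
    using lt[OF that] abs_Re_le_cmod[of "p z - 1"] sqrt_two_bounds by auto
  then have p0: "p z \<noteq> 0" if "z \<in> \<D>" for z
    using that by force
  show "(\<lambda>z. (p z - 1 / p z) / 2) holomorphic_on \<D>"
    using p p0 by (intro holomorphic_intros) auto
  have "norm (z\<^sup>2) < 1" if "norm z < 1" for z :: complex
    using that by (simp add: norm_power power_less_one_iff)
  then show "(\<lambda>z. z + csqrt (1 + z\<^sup>2)) holomorphic_on \<D>"
    by (intro holomorphic_intros one_plus_in_disc_nonpos_Reals) auto
  fix z assume z: "z \<in> \<D>"
  have "csqrt (1 + ((p z - 1 / p z) / 2)\<^sup>2) = (p z + 1 / p z) / 2"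
  proof (rule csqrt_unique)
    show "((p z + 1 / p z) / 2)\<^sup>2 = 1 + ((p z - 1 / p z) / 2)\<^sup>2"
      using p0[OF z] by (simp add: power2_eq_square field_simps)
    have "Re (1 / p z) > 0" using Re[OF z] by (simp add: Re_divide sum_power2_gt_zero_iff)
    then show "0 < Re ((p z + 1 / p z) / 2) \<or>
        Re ((p z + 1 / p z) / 2) = 0 \<and> 0 \<le> Im ((p z + 1 / p z) / 2)"
      using Re[OF z] by simp
  qed
  then show "p z = (p z - 1 / p z) / 2 + csqrt (1 + ((p z - 1 / p z) / 2)\<^sup>2)"
    by (simp add: field_simps)
  show "norm ((p z - 1 / p z) / 2) \<noteq> 1"
  proof
    assume "norm ((p z - 1 / p z) / 2) = 1"
    then have eq2: "norm (p z - 1 / p z) = 2" by (simp add: norm_divide)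
    define d where "d = norm (p z - 1)"
    have d: "d < 2 - sqrt 2" using lt[OF z] by (simp add: d_def)
    have np: "sqrt 2 - 1 < norm (p z)" using d norm_triangle_ineq2[of 1 "1 - p z"]
      by (simp add: d_def norm_minus_commute)
    \<comment> \<open>Both factors are largest in norm towards \<open>p = sqrt 2 - 1\<close>, the
      image of \<open>w = -1\<close>, where the product has norm exactly 2.\<close>
    have "p z - 1 / p z = (p z - 1) * (1 + 1 / p z)"
      using p0[OF z] by (simp add: field_simps)
    then have "2 = d * norm (1 + 1 / p z)" using eq2 by (simp add: norm_mult d_def)
    also have "\<dots> \<le> d * (1 + 1 / norm (p z))"
      using norm_triangle_ineq[of 1 "1 / p z"] by (intro mult_left_mono) (auto simp: d_def norm_divide)
    also have "\<dots> \<le> d * (1 + 1 / (sqrt 2 - 1))"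
      using np sqrt_two_bounds p0[OF z]
      by (intro mult_left_mono add_left_mono divide_left_mono mult_pos_pos) (auto simp: d_def)
    also have "\<dots> < (2 - sqrt 2) * (1 + 1 / (sqrt 2 - 1))"
      using d sqrt_two_bounds by (intro mult_strict_right_mono add_pos_pos) auto
    also have "\<dots> = 2" using sqrt_two_bounds by (simp add: field_simps)
    finally show False by simp
  qed
qed (use p in auto)

text \<open>The target is \<open>1 / 3 + 2 / 3 * (w + 1)^2\<close>, inverted by a square root. On
  the unit circle its distance from 1 is at least \<open>4 / 3 - 2 / 3\<close>.\<close>

lemma subordinate_quadratic:
  assumes p: "p holomorphic_on \<D>" "p 0 = 1"
    and lt: "\<And>z. z \<in> \<D> \<Longrightarrow> norm (p z - 1) < 2 / 3"
  shows "p \<prec>\<^sub>\<D> (\<lambda>z. 1 + 4 / 3 * z + 2 / 3 * z\<^sup>2)"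
proof (rule subordinateI[where w = "\<lambda>z. csqrt (1 + 3 / 2 * (p z - 1)) - 1"])
  have "norm (3 / 2 * (p z - 1)) < 1" if "z \<in> \<D>" for z
    unfolding norm_mult using lt[OF that] by simp
  then show "(\<lambda>z. csqrt (1 + 3 / 2 * (p z - 1)) - 1) holomorphic_on \<D>"
    using p by (intro holomorphic_intros one_plus_in_disc_nonpos_Reals)
  fix z assume z: "z \<in> \<D>"
  define w where "w = csqrt (1 + 3 / 2 * (p z - 1)) - 1"
  have "(w + 1)\<^sup>2 = 1 + 3 / 2 * (p z - 1)" by (simp add: w_def)
  then have eq: "p z = 1 + 4 / 3 * w + 2 / 3 * w\<^sup>2"
    by (simp add: power2_eq_square field_simps)
  then show "p z = 1 + 4 / 3 * (csqrt (1 + 3 / 2 * (p z - 1)) - 1) +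
        2 / 3 * (csqrt (1 + 3 / 2 * (p z - 1)) - 1)\<^sup>2"
    by (simp add: w_def)
  show "norm (csqrt (1 + 3 / 2 * (p z - 1)) - 1) \<noteq> 1"
  proof
    assume "norm (csqrt (1 + 3 / 2 * (p z - 1)) - 1) = 1"
    then have "norm w = 1" by (simp add: w_def)
    moreover have "norm (4 / 3 * w) \<le> norm (p z - 1) + norm (2 / 3 * w\<^sup>2)"
      using norm_triangle_ineq4[of "p z - 1" "2 / 3 * w\<^sup>2"] eq by simp
    ultimately show False using lt[OF z] by (simp add: norm_mult norm_power)
  qed
qed (use p in \<open>auto intro!: holomorphic_intros\<close>)

section \<open>The Moebius and the lemniscate target\<close>

text \<open>In the variable \<open>V = \<beta> * (p - 1)\<close> the target is the disc with
  diameter \<open>[-Y, X]\<close>. The two conditions on \<open>\<beta>\<close> say that it contains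
  the disc of \<open>subord_class_chord_bound\<close>.\<close>

lemma subordinate_mobius:
  fixes A B \<beta> :: real
  assumes p: "p \<in> subord_class \<beta>" and AB: "-1 < B" "B < A" "A < 1"
    and left: "\<beta> \<ge> 2 * (1 - B) * (1 - ln 2) / (A - B)"
    and right: "\<beta> \<ge> (1 + B) * dominant_real 1 / (A - B)"
  shows "p \<prec>\<^sub>\<D> (\<lambda>z. (1 + of_real A * z) / (1 + of_real B * z))"
proof -
  define T where "T = \<beta> * (A - B)"
  define X Y where "X = T / (1 + B)" and "Y = T / (1 - B)"
  have X: "dominant_real 1 \<le> X" and Y: "2 * (1 - ln 2) \<le> Y"
    using left right AB by (simp_all add: X_def Y_def T_def field_simps)
  have "0 < 2 * (1 - ln (2::real))" using ln_2_less_1 by simp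
  then have Ypos: "Y > 0" using Y by linarith
  then have T: "T > 0" using AB by (simp add: Y_def zero_less_divide_iff)
  then have \<beta>: "\<beta> > 0" using AB by (simp add: T_def zero_less_mult_iff)
  have B1: "0 < 1 - B\<^sup>2" using AB by (simp add: abs_square_less_1)
  have hol: "p holomorphic_on \<D>" using p by (rule subord_class_holomorphic)
  have lt: "norm (p z - 1) < norm (of_real A - of_real B * p z)" if z: "z \<in> \<D>" for z
  proof -
    define V where "V = of_real \<beta> * (p z - 1)"
    \<comment> \<open>The centre of the disc with diameter \<open>[-Y, X]\<close>.\<close>
    define c where "c = (X - Y) / 2"
    have "norm (V - of_real c) < (X + Y) / 2"
    proof (cases "V = of_real c")
      case True
      have "X > 0" using T AB by (simp add: X_def)
      then show ?thesis using True Ypos by simp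
    next
      case False
      define u where "u = sgn (V - of_real c)"
      have u: "norm u = 1" using False by (simp add: u_def norm_sgn)
      have C: "-1 \<le> Re u" "Re u \<le> 1" using u abs_Re_le_cmod[of u] by auto
      have "norm (V - of_real c) = Re (cnj u * (V - of_real c))"
        unfolding u_def by (rule Re_cnj_sgn_mult[symmetric])
      also have "\<dots> = Re (cnj u * V) - Re u * c" by (simp add: algebra_simps)
      also have "Re (cnj u * V) < (1 + Re u) / 2 * dominant_real 1 + (1 - Re u) / 2 * (2 * (1 - ln 2))"
        unfolding V_def by (rule subord_class_chord_bound[OF p z u])
      also have "\<dots> \<le> (1 + Re u) / 2 * X + (1 - Re u) / 2 * Y"
        using X Y C by (intro add_mono mult_left_mono) auto
      finally show ?thesis by (simp add: c_def field_simps)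
    qed
    then have "(norm (V - of_real c))\<^sup>2 < ((X + Y) / 2)\<^sup>2" by (intro power_strict_mono) auto
    moreover have "(norm (V - of_real c))\<^sup>2 = (norm V)\<^sup>2 - 2 * c * Re V + c\<^sup>2"
      unfolding cmod_power2 by (simp add: power2_eq_square algebra_simps)
    moreover have "((X + Y) / 2)\<^sup>2 = X * Y + c\<^sup>2" "2 * c = X - Y"
      by (simp_all add: c_def power2_eq_square field_simps)
    ultimately have "(norm V)\<^sup>2 - (X - Y) * Re V < X * Y"
      by simp
    \<comment> \<open>Scaling by \<open>1 - B^2\<close> clears the denominators of \<open>X\<close>
      and \<open>Y\<close> and turns the disc into \<open>norm V < norm (T - B * V)\<close>.\<close>
    then have "(1 - B\<^sup>2) * ((norm V)\<^sup>2 - (X - Y) * Re V) < (1 - B\<^sup>2) * (X * Y)"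
      using B1 by (rule mult_strict_left_mono)
    moreover have "(1 - B\<^sup>2) * (X * Y) = T\<^sup>2"
    proof -
      have "(1 - B\<^sup>2) * (X * Y) = ((1 + B) * X) * ((1 - B) * Y)"
        by (simp add: power2_eq_square algebra_simps)
      then show ?thesis using AB by (simp add: X_def Y_def power2_eq_square)
    qed
    moreover have "(1 - B\<^sup>2) * (X - Y) = - (2 * B * T)"
    proof -
      have "(1 - B\<^sup>2) * (X - Y) = (1 - B) * ((1 + B) * X) - (1 + B) * ((1 - B) * Y)"
        by (simp add: power2_eq_square algebra_simps)
      also have "\<dots> = (1 - B) * T - (1 + B) * T" using AB by (simp add: X_def Y_def)
      finally show ?thesis by (simp add: algebra_simps)
    qed
    moreover have "(1 - B\<^sup>2) * ((norm V)\<^sup>2 - (X - Y) * Re V)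
        = (1 - B\<^sup>2) * (norm V)\<^sup>2 - (1 - B\<^sup>2) * (X - Y) * Re V"
      by (simp add: right_diff_distrib)
    ultimately have *: "(1 - B\<^sup>2) * (norm V)\<^sup>2 + 2 * B * T * Re V < T\<^sup>2"
      by simp
    have "(norm (of_real T - of_real B * V))\<^sup>2 = T\<^sup>2 - 2 * B * T * Re V + B\<^sup>2 * (norm V)\<^sup>2"
      unfolding cmod_power2 by (simp add: power2_eq_square algebra_simps)
    then have "(norm V)\<^sup>2 < (norm (of_real T - of_real B * V))\<^sup>2"
      using * by (simp add: algebra_simps)
    then have "norm V < norm (of_real T - of_real B * V)" by (rule power2_less_imp_less) simp
    moreover have "of_real T - of_real B * V = of_real \<beta> * (of_real A - of_real B * p z)"
      by (simp add: V_def T_def algebra_simps)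
    ultimately show ?thesis using \<beta> by (simp add: V_def norm_mult)
  qed
  then have ne: "of_real A - of_real B * p z \<noteq> 0" if "z \<in> \<D>" for z
    using that by fastforce
  show ?thesis
  proof (rule subordinateI[where w = "\<lambda>z. (p z - 1) / (of_real A - of_real B * p z)"])
    show "(\<lambda>z. (p z - 1) / (of_real A - of_real B * p z)) holomorphic_on \<D>"
      using ne hol by (intro holomorphic_intros) auto
    have "1 + of_real B * z \<noteq> 0" if "z \<in> \<D>" for z
    proof
      assume "1 + of_real B * z = 0"
      then have "norm (of_real B * z) = 1" by (metis add_eq_0_iff norm_minus_cancel norm_one)
      moreover have "\<bar>B\<bar> * norm z \<le> 1 * norm z" using AB by (intro mult_right_mono) auto
      ultimately show False using that by (simp add: norm_mult)
    qed
    then show "(\<lambda>z. (1 + of_real A * z) / (1 + of_real B * z)) holomorphic_on \<D>"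
      by (intro holomorphic_intros) auto
    fix z assume z: "z \<in> \<D>"
    define d where "d = of_real A - of_real B * p z"
    have d: "d \<noteq> 0" using ne[OF z] by (simp add: d_def)
    have AB0: "of_real A - of_real B \<noteq> (0 :: complex)" using AB by simp
    have "1 + of_real A * ((p z - 1) / d) = p z * (of_real A - of_real B) / d"
      "1 + of_real B * ((p z - 1) / d) = (of_real A - of_real B) / d"
      using d by (simp_all add: field_simps) (simp_all add: d_def algebra_simps)
    then show "p z = (1 + of_real A * ((p z - 1) / (of_real A - of_real B * p z))) /
        (1 + of_real B * ((p z - 1) / (of_real A - of_real B * p z)))"
      using d AB0 by (simp flip: d_def)
    show "norm ((p z - 1) / (of_real A - of_real B * p z)) \<noteq> 1"
      using lt[OF z] ne[OF z] by (simp add: norm_divide)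
  qed (use p hol in \<open>auto simp: subord_class_def\<close>)
qed

section \<open>Numerical bounds and the lemniscate target\<close>

lemma dominant_real_1_lower_bound: "dominant_real 1 > 2 * (sqrt 2 - 1 - 19 / 100)"
proof -
  \<comment> \<open>\<open>19 / 100\<close> exceeds \<open>ln ((1 + sqrt 2) / 2)\<close>: the Taylor
    polynomial is 1.20805, while \<open>(1 + sqrt 2) / 2\<close> is below 1.2075.\<close>
  have "1 + 19 / 100 + (19 / 100)\<^sup>2 / 2 \<le> exp (19 / 100 :: real)"
    by (rule exp_lower_Taylor_quadratic) simp
  then have "(1 + sqrt 2) / 2 < exp (19 / 100)"
    using sqrt_two_bounds by (simp add: power2_eq_square)
  moreover have "0 < (1 + sqrt 2) / 2" using sqrt_two_bounds by simp
  ultimately have "ln ((1 + sqrt 2) / 2) < 19 / 100"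
    using ln_less_cancel_iff[of "(1 + sqrt 2) / 2" "exp (19 / 100)"] by simp
  then show ?thesis by (simp add: dominant_real_def)
qed

lemma ln_two_lower_bound: "ln (2::real) > 69 / 100"
  using ln_approx_bounds[of 2 2] by (simp add: eval_nat_numeral)

text \<open>The half-plane bounds for \<open>Re u \<ge> 0\<close> confine the right part of the image to a disc through
  \<open>sqrt 2\<close> that lies inside the lemniscate.\<close>

lemma disc_in_lemniscate:
  fixes a b m :: real
  assumes m: "2 * sqrt 2 / 3 \<le> m" "m \<le> 1" and ab: "(a - m)\<^sup>2 + b\<^sup>2 < (sqrt 2 - m)\<^sup>2"
  shows "(a\<^sup>2 + b\<^sup>2)\<^sup>2 < 2 * (a\<^sup>2 - b\<^sup>2)"
proof -
  define N v where "N = a\<^sup>2 + b\<^sup>2" and "v = sqrt 2 - a"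
  have N0: "N \<ge> 0" by (simp add: N_def)
  \<comment> \<open>The disc condition is linear in \<open>N\<close>; the claim is equivalent to
    \<open>N^2 + 2 * N < 4 * a^2\<close>.\<close>
  have "N < 2 - 2 * m * v"
    using ab by (simp add: N_def v_def power2_eq_square algebra_simps)
  then have "N\<^sup>2 + 2 * N < (2 - 2 * m * v)\<^sup>2 + 2 * (2 - 2 * m * v)"
    using N0 by (intro add_strict_mono power_strict_mono) auto
  also have "\<dots> = 4 * a\<^sup>2 + 4 * v * (2 * sqrt 2 - 3 * m) - 4 * v\<^sup>2 * (1 - m\<^sup>2)"
    by (simp add: v_def power2_eq_square algebra_simps)
  also have "\<dots> \<le> 4 * a\<^sup>2"
  proof -
    have "(a - m)\<^sup>2 < (sqrt 2 - m)\<^sup>2" using ab zero_le_power2[of b] by linarith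
    moreover have "0 \<le> sqrt 2 - m" using m sqrt_two_bounds by linarith
    ultimately have "a - m < sqrt 2 - m" by (rule power2_less_imp_less)
    then have "v \<ge> 0" by (simp add: v_def)
    then have "4 * v * (2 * sqrt 2 - 3 * m) \<le> 0" using m by (intro mult_nonneg_nonpos) auto
    moreover have "0 \<le> 4 * v\<^sup>2 * (1 - m\<^sup>2)"
      using m sqrt_two_bounds by (intro mult_nonneg_nonneg) (auto simp: abs_square_le_1)
    ultimately show ?thesis by linarith
  qed
  finally show ?thesis by (simp add: N_def)
qed

text \<open>Treats the part with \<open>a \<le> 1\<close>. For \<open>p = a + \<i> * b\<close> the
  claim is \<open>norm (p - 1) * norm (p + 1) < 1\<close>; with \<open>M\<close> the square of
  \<open>norm (p - 1)\<close>, the square of \<open>norm (p + 1)\<close> is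
  \<open>M + 4 - 4 * x\<close>.\<close>

lemma strip_in_lemniscate:
  fixes a b :: real
  assumes b: "b\<^sup>2 \<le> (93 / 200)\<^sup>2" and Y: "(a - 1)\<^sup>2 + b\<^sup>2 \<le> (23 / 40)\<^sup>2" and a: "a \<le> 1"
  shows "(a\<^sup>2 + b\<^sup>2)\<^sup>2 < 2 * (a\<^sup>2 - b\<^sup>2)"
proof -
  define x M where "x = 1 - a" and "M = (a - 1)\<^sup>2 + b\<^sup>2"
  have M0: "M \<ge> 0" by (simp add: M_def)
  have x: "x \<ge> 0" using a by (simp add: x_def)
  have Mx: "M \<le> x\<^sup>2 + (93 / 200)\<^sup>2" using b by (simp add: M_def x_def power2_eq_square algebra_simps)
  have pos: "M + 4 - 4 * x \<ge> 0"
  proof -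
    have "x\<^sup>2 + 4 - 4 * x \<le> M + 4 - 4 * x" by (simp add: M_def x_def power2_eq_square algebra_simps)
    moreover have "x\<^sup>2 + 4 - 4 * x = (x - 2)\<^sup>2" by (simp add: power2_eq_square algebra_simps)
    ultimately show ?thesis by (metis order.trans zero_le_power2)
  qed
  have "M * (M + 4 - 4 * x) < 1"
  \<comment> \<open>Far from 1 the disc bound on \<open>M\<close> suffices; near 1 the strip bound
    leaves a concave quadratic in \<open>x\<close>.\<close>
  proof (cases "x \<ge> 1 / 3")
    case True
    have "M * (M + 4 - 4 * x) \<le> (23 / 40)\<^sup>2 * ((23 / 40)\<^sup>2 + 4 - 4 * (1 / 3))"
      using True Y M0 pos by (intro mult_mono) (auto simp: M_def)
    then show ?thesis by (simp add: power2_eq_square)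
  next
    case False
    define h :: real where "h = (93 / 200)\<^sup>2"
    have xx: "x\<^sup>2 \<le> x * (1 / 3)" using False x unfolding power2_eq_square by (intro mult_left_mono) auto
    have "M * (M + 4 - 4 * x) \<le> (x / 3 + h) * (x / 3 + h + 4 - 4 * x)"
      using Mx M0 pos xx x by (intro mult_mono) (auto simp: h_def)
    also have "\<dots> < 1"
    proof -
      \<comment> \<open>\<open>1 / 4\<close> is close to the maximiser of that quadratic.\<close>
      have "0 \<le> (x - 1 / 4)\<^sup>2" by simp
      then show ?thesis using x False by (simp add: h_def power2_eq_square algebra_simps)
    qed
    finally show ?thesis .
  qed
  moreover have "(a\<^sup>2 + b\<^sup>2)\<^sup>2 - 2 * (a\<^sup>2 - b\<^sup>2) = M * (M + 4 - 4 * x) - 1"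
    by (simp add: M_def x_def power2_eq_square algebra_simps)
  ultimately show ?thesis by simp
qed

text \<open>The target is inverted by \<open>p^2 - 1\<close>. The image of \<open>p\<close> is split
  at \<open>Re p = m\<close>: the right part lies in a disc, the left part in a strip cut by a disc
  about 1, and both fit into the lemniscate.\<close>

lemma subordinate_csqrt:
  assumes p: "p \<in> subord_class \<beta>" and \<beta>: "\<beta> \<ge> dominant_real 1 / (sqrt 2 - 1)"
  shows "p \<prec>\<^sub>\<D> (\<lambda>z. csqrt (1 + z))"
proof -
  have s: "0 < sqrt 2 - 1" using sqrt_two_bounds by simp
  have X: "dominant_real 1 \<le> \<beta> * (sqrt 2 - 1)" using \<beta> s by (simp add: field_simps)
  \<comment> \<open>Division by \<open>sqrt 2 - 1\<close> is multiplication by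
    \<open>sqrt 2 + 1\<close>; this leads to \<open>\<beta> > 108 / 100\<close>, which determines
    the later constants.\<close>
  have "2 * (sqrt 2 - 1 - 19 / 100) = (2 - 38 / 100 * (sqrt 2 + 1)) * (sqrt 2 - 1)"
    by (simp add: algebra_simps)
  then have "(2 - 38 / 100 * (sqrt 2 + 1)) * (sqrt 2 - 1) < \<beta> * (sqrt 2 - 1)"
    using dominant_real_1_lower_bound X by linarith
  then have "2 - 38 / 100 * (sqrt 2 + 1) < \<beta>" using s by (simp only: mult_less_cancel_right_pos)
  then have "200 < 100 * \<beta> + 38 * sqrt 2 + 38" by (simp add: field_simps)
  then have \<beta>1: "\<beta> > 108 / 100" using sqrt_two_bounds by simp
  have hol: "p holomorphic_on \<D>" using p by (rule subord_class_holomorphic)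
  have norm_lt: "norm (p z - 1) < 23 / 40" if "z \<in> \<D>" for z
  proof (rule subord_class_norm_less[OF p that])
    have "2 * (1 - ln 2) / (23 / 40) \<le> (108 / 100 :: real)"
      using ln_two_lower_bound by simp
    then show "2 * (1 - ln 2) / (23 / 40) \<le> \<beta>" using \<beta>1 by linarith
  qed simp
  \<comment> \<open>\<open>\<delta>\<close> slightly exceeds \<open>1 / (2 * \<beta>)\<close> at
    \<open>\<beta> = 108 / 100\<close>. The bound \<open>right\<close> is the support function,
    relative to 1, of the disc of radius \<open>\<delta>\<close> about \<open>m\<close>, which
    touches \<open>sqrt 2\<close>.\<close>
  define \<delta> m :: real where "\<delta> = 93 / 200" and "m = sqrt 2 - \<delta>"
  have \<delta>: "1 \<le> 2 * \<beta> * \<delta>" using \<beta>1 by (simp add: \<delta>_def)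
  have right: "Re (cnj u * (p z - 1)) < Re u * (sqrt 2 - 1) + (1 - Re u) * \<delta>"
    if z: "z \<in> \<D>" and u: "norm u = 1" "Re u \<ge> 0" for z u
  proof -
    have "\<beta> * Re (cnj u * (p z - 1)) = Re (cnj u * (of_real \<beta> * (p z - 1)))"
      by (simp add: algebra_simps)
    also have "\<dots> < Re u * dominant_real 1 + (1 - Re u) / 2"
      by (rule subord_class_right_bound[OF p z u])
    also have "\<dots> \<le> Re u * (\<beta> * (sqrt 2 - 1)) + (1 - Re u) / 2"
      using X u by (intro add_right_mono mult_left_mono) auto
    also have "\<dots> \<le> Re u * (\<beta> * (sqrt 2 - 1)) + (1 - Re u) / 2 * (2 * \<beta> * \<delta>)"
    proof -
      have "(1 - Re u) / 2 * 1 \<le> (1 - Re u) / 2 * (2 * \<beta> * \<delta>)"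
        using \<delta> u abs_Re_le_cmod[of u] by (intro mult_left_mono) auto
      then show ?thesis by simp
    qed
    also have "\<dots> = \<beta> * (Re u * (sqrt 2 - 1) + (1 - Re u) * \<delta>)"
      by (simp add: field_simps)
    finally show ?thesis using \<beta>1 by simp
  qed
  have lt: "norm ((p z)\<^sup>2 - 1) < 1" if z: "z \<in> \<D>" for z
  proof -
    define a b where "a = Re (p z)" and "b = Im (p z)"
    have "(a\<^sup>2 + b\<^sup>2)\<^sup>2 < 2 * (a\<^sup>2 - b\<^sup>2)"
    \<comment> \<open>To the right of \<open>m\<close> the direction from \<open>m\<close> to
      \<open>p z\<close> has \<open>Re u \<ge> 0\<close>, so \<open>right\<close> applies to it;
      otherwise \<open>right\<close> is used only for \<open>u = \<i>\<close> and
      \<open>u = -\<i>\<close>.\<close>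
    proof (cases "a \<ge> m")
      case True
      have "norm (p z - of_real m) < \<delta>"
      proof (cases "p z = of_real m")
        case False
        define u where "u = sgn (p z - of_real m)"
        have u: "norm u = 1" using False by (simp add: u_def norm_sgn)
        have "Re u = (a - m) / norm (p z - of_real m)"
          by (simp add: u_def sgn_div_norm a_def divide_inverse)
        then have u': "Re u \<ge> 0" using True by simp
        have "norm (p z - of_real m) = Re (cnj u * (p z - of_real m))"
          unfolding u_def by (rule Re_cnj_sgn_mult[symmetric])
        also have "\<dots> = Re (cnj u * (p z - 1)) - Re u * (m - 1)" by (simp add: algebra_simps)
        also have "\<dots> < \<delta>" using right[OF z u u'] by (simp add: m_def algebra_simps)
        finally show ?thesis .
      qed (simp add: \<delta>_def)
      then have "(norm (p z - of_real m))\<^sup>2 < \<delta>\<^sup>2" by (intro power_strict_mono) auto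
      then have "(a - m)\<^sup>2 + b\<^sup>2 < (sqrt 2 - m)\<^sup>2"
        by (simp add: cmod_power2 a_def b_def m_def)
      moreover have "2 * sqrt 2 / 3 \<le> m" "m \<le> 1"
        using sqrt_two_bounds by (simp_all add: m_def \<delta>_def)
      ultimately show ?thesis by (intro disc_in_lemniscate)
    next
      case False
      have "b < \<delta>" "- b < \<delta>"
        using right[OF z, of "\<i>"] right[OF z, of "-\<i>"] by (simp_all add: b_def)
      then have "b\<^sup>2 \<le> (93 / 200)\<^sup>2" by (intro abs_le_square_iff[THEN iffD1]) (auto simp: \<delta>_def)
      moreover have "(a - 1)\<^sup>2 + b\<^sup>2 \<le> (23 / 40)\<^sup>2"
        using power_strict_mono[OF norm_lt[OF z], of 2] by (simp add: cmod_power2 a_def b_def)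
      moreover have "a \<le> 1" using False sqrt_two_bounds by (simp add: m_def \<delta>_def)
      ultimately show ?thesis by (intro strip_in_lemniscate)
    qed
    then have "(norm ((p z)\<^sup>2 - 1))\<^sup>2 < 1\<^sup>2"
      unfolding cmod_power2 by (simp add: a_def b_def power2_eq_square algebra_simps)
    then show ?thesis by (rule power2_less_imp_less) simp
  qed
  have Re: "Re (p z) > 0" if "z \<in> \<D>" for z
    using norm_lt[OF that] abs_Re_le_cmod[of "p z - 1"] by simp
  show ?thesis
  proof (rule subordinateI[where w = "\<lambda>z. (p z)\<^sup>2 - 1"])
    show "(\<lambda>z. csqrt (1 + z)) holomorphic_on \<D>"
      by (intro holomorphic_intros one_plus_in_disc_nonpos_Reals) auto
    show "p z = csqrt (1 + ((p z)\<^sup>2 - 1))" if "z \<in> \<D>" for z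
      using Re[OF that] csqrt_square[of "p z"] by simp
    show "norm ((p z)\<^sup>2 - 1) \<noteq> 1" if "z \<in> \<D>" for z
      using lt[OF that] by simp
  qed (use p hol in \<open>auto simp: subord_class_def intro!: holomorphic_intros\<close>)
qed

section \<open>Sharpness\<close>

text \<open>Continues \<open>dominant_real\<close> to the disc; the argument of \<open>Ln\<close>
  has real part at least \<open>1 / 2\<close>, so the principal branch is holomorphic there.\<close>

definition dominant :: "complex \<Rightarrow> complex" where
  "dominant z = 2 * (csqrt (1 + z) - 1 - Ln ((1 + csqrt (1 + z)) / 2))"

lemma dominant_of_real:
  assumes "x \<ge> -1"
  shows "dominant (of_real x) = of_real (dominant_real x)"
proof -
  define s where "s = sqrt (1 + x)"
  have s: "s \<ge> 0" using assms by (simp add: s_def)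
  have "csqrt (1 + of_real x) = of_real s"
    using csqrt_of_real[of "1 + x"] assms by (simp add: s_def)
  moreover have "Ln ((1 + of_real s) / 2) = of_real (ln ((1 + s) / 2))"
    using Ln_of_real[of "(1 + s) / 2"] s by simp
  ultimately show ?thesis
    unfolding dominant_def dominant_real_def by (simp add: s_def)
qed

lemma one_plus_csqrt_nonzero: "1 + csqrt z \<noteq> 0"
proof
  assume "1 + csqrt z = 0"
  then have "csqrt z = - 1" by (rule minus_unique[symmetric])
  from arg_cong[OF this, of Re] have "Re (csqrt z) = - 1"
    by (simp only: uminus_complex.simps one_complex.simps)
  then show False using Re_csqrt[of z] by linarith
qed

lemma has_field_derivative_dominant:
  assumes "z \<in> \<D>"
  shows "(dominant has_field_derivative 1 / (1 + csqrt (1 + z))) (at z)"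
proof -
  define s where "s = csqrt (1 + z)"
  have z: "1 + z \<notin> \<real>\<^sub>\<le>\<^sub>0" using assms by (intro one_plus_in_disc_nonpos_Reals) simp
  then have s0: "s \<noteq> 0" by (auto simp: s_def)
  have Re: "Re s \<ge> 0" unfolding s_def by (rule Re_csqrt)
  then have nonpos: "(1 + s) / 2 \<notin> \<real>\<^sub>\<le>\<^sub>0"
    by (auto simp: complex_nonpos_Reals_iff)
  have s1: "1 + s \<noteq> 0" unfolding s_def by (rule one_plus_csqrt_nonzero)
  have "2 + 2 * s = 2 * (1 + s)" by (simp only: distrib_left mult_1_right)
  then have s2: "2 + 2 * s \<noteq> 0" using s1 by (simp only: mult_eq_0_iff) simp
  have sq: "((\<lambda>z. csqrt (1 + z)) has_field_derivative 1 / (2 * s)) (at z)"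
    using z by (auto intro!: derivative_eq_intros simp: s_def)
  have "((\<lambda>z. (1 + csqrt (1 + z)) / 2) has_field_derivative 1 / (2 * s) / 2) (at z)"
    by (rule DERIV_cdivide, rule DERIV_cong, rule DERIV_add[OF DERIV_const sq]) simp
  then have "((\<lambda>z. Ln ((1 + csqrt (1 + z)) / 2)) has_field_derivative
      inverse ((1 + s) / 2) * (1 / (2 * s) / 2)) (at z)"
    unfolding s_def
    by (rule DERIV_chain2[rotated, OF _ has_field_derivative_Ln])
       (use nonpos in \<open>simp add: s_def\<close>)
  then have "(dominant has_field_derivative
      2 * (1 / (2 * s) - 0 - inverse ((1 + s) / 2) * (1 / (2 * s) / 2))) (at z)"
    unfolding dominant_def[abs_def]
    by (intro DERIV_cmult DERIV_diff sq DERIV_const)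
  moreover have "2 * (1 / (2 * s) - 0 - inverse ((1 + s) / 2) * (1 / (2 * s) / 2)) = 1 / (1 + s)"
    using s0 s1 s2 by (simp add: divide_simps)
  ultimately show ?thesis by (simp add: s_def)
qed

text \<open>The hypothesis of the class holds with the identity as subordinating function, since
  \<open>z * dominant' = csqrt (1 + z) - 1\<close>.\<close>

lemma extremal_in_subord_class:
  assumes "\<beta> \<noteq> 0"
  shows "(\<lambda>z. 1 + dominant z / of_real \<beta>) \<in> subord_class \<beta>"
proof -
  have der: "((\<lambda>z. 1 + dominant z / of_real \<beta>) has_field_derivative
      1 / (1 + csqrt (1 + z)) / of_real \<beta>) (at z)" if "z \<in> \<D>" for z
    using DERIV_add[OF DERIV_const[of 1] DERIV_cdivide[OF has_field_derivative_dominant[OF that]]]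
    by simp
  have hol: "(\<lambda>z. csqrt (1 + z)) holomorphic_on \<D>"
    by (intro holomorphic_intros one_plus_in_disc_nonpos_Reals) auto
  have eq: "1 + of_real \<beta> * z * deriv (\<lambda>z. 1 + dominant z / of_real \<beta>) z = csqrt (1 + z)"
    if "z \<in> \<D>" for z
  proof -
    define s where "s = csqrt (1 + z)"
    have "z = (s - 1) * (1 + s)"
      using power2_csqrt[of "1 + z"] by (simp add: s_def power2_eq_square algebra_simps)
    moreover have "1 + s \<noteq> 0" unfolding s_def by (rule one_plus_csqrt_nonzero)
    ultimately have "z * (1 / (1 + s)) = s - 1" by (simp add: field_simps)
    then show ?thesis
      using DERIV_imp_deriv[OF der[OF that]] assms by (simp flip: s_def)
  qed
  have "(\<lambda>z. 1 + of_real \<beta> * z * deriv (\<lambda>z. 1 + dominant z / of_real \<beta>) z)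
      \<prec>\<^sub>\<D> (\<lambda>z. csqrt (1 + z))"
  proof (rule subordinateI[where w = "\<lambda>z. z"])
    show "(\<lambda>z. 1 + of_real \<beta> * z * deriv (\<lambda>z. 1 + dominant z / of_real \<beta>) z) holomorphic_on \<D>"
      using hol by (rule holomorphic_transform) (use eq in simp)
  qed (use eq hol in \<open>auto intro: holomorphic_intros\<close>)
  moreover have "(\<lambda>z. 1 + dominant z / of_real \<beta>) holomorphic_on \<D>"
    unfolding holomorphic_on_open[OF open_ball] using der by blast
  moreover have "dominant 0 = 0" using dominant_of_real[of 0] by simp
  ultimately show ?thesis by (simp add: subord_class_def analytic_on_open)
qed

text \<open>A single value of the extremal function omitted by the target refutes subordination. The
  auxiliary \<open>c\<close> allows attention to be confined to \<open>\<beta>\<close> close to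
  \<open>b\<close>.\<close>

lemma sharp_boundI:
  assumes "0 < b" "c < b"
    and omit: "\<And>\<beta>. 0 < \<beta> \<Longrightarrow> c < \<beta> \<Longrightarrow> \<beta> < b \<Longrightarrow>
      \<exists>x\<in>{-1<..<1}. \<forall>w\<in>\<D>. \<phi> w \<noteq> of_real (1 + dominant_real x / \<beta>)"
  shows "sharp_bound \<phi> b"
  unfolding sharp_bound_def
proof (intro allI impI notI)
  fix b' assume b': "b' < b" and all: "\<forall>\<beta>\<ge>b'. \<forall>p\<in>subord_class \<beta>. p \<prec>\<^sub>\<D> \<phi>"
  \<comment> \<open>\<open>\<beta>\<close> has to be positive, exceed \<open>c\<close> for
    \<open>omit\<close>, and exceed \<open>b'\<close>, which may be negative.\<close>
  obtain \<beta> where \<beta>: "Max {0, c, b'} < \<beta>" "\<beta> < b"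
    using dense[of "Max {0, c, b'}" b] assms b' by auto
  then obtain x where x: "x \<in> {-1<..<1}" and
    ne: "\<And>w. w \<in> \<D> \<Longrightarrow> \<phi> w \<noteq> of_real (1 + dominant_real x / \<beta>)"
    using omit[of \<beta>] by auto
  have "(\<lambda>z. 1 + dominant z / of_real \<beta>) \<prec>\<^sub>\<D> \<phi>"
  proof -
    have "b' \<le> \<beta>" "\<beta> \<noteq> 0" using \<beta> by auto
    then show ?thesis using all extremal_in_subord_class by blast
  qed
  then obtain w where "w \<in> \<D> \<rightarrow> \<D>" "\<And>z. z \<in> \<D> \<Longrightarrow> 1 + dominant z / of_real \<beta> = \<phi> (w z)"
    unfolding subordinate_def by auto
  moreover have "of_real x \<in> \<D>" using x by (simp add: abs_if)
  ultimately have "w (of_real x) \<in> \<D>" "\<phi> (w (of_real x)) = 1 + dominant (of_real x) / of_real \<beta>"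
    by (auto simp: Pi_iff)
  then show False using ne dominant_of_real[of x] x by force
qed

text \<open>Below the threshold \<open>1 + dominant_real (-1) / \<beta>\<close> drops under
  \<open>1 - s\<close>, so by continuity an omitted value is taken inside the disc. As omission is
  assumed only on a bounded interval, \<open>\<beta> > 2 * (1 - ln 2) / t\<close> keeps that value
  above \<open>1 - t\<close>.\<close>

lemma sharp_bound_left:
  assumes st: "0 < s" "s < t"
    and omit: "\<And>v w. 1 - t < v \<Longrightarrow> v < 1 - s \<Longrightarrow> w \<in> \<D> \<Longrightarrow> \<phi> w \<noteq> of_real v"
  shows "sharp_bound \<phi> (2 * (1 - ln 2) / s)"
proof (rule sharp_boundI)
  define Y :: real where "Y = 2 * (1 - ln 2)"
  have Y: "Y > 0" using ln_2_less_1 by (simp add: Y_def)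
  show "0 < 2 * (1 - ln 2) / s" "2 * (1 - ln 2) / t < 2 * (1 - ln 2) / s"
    using Y st unfolding Y_def[symmetric] by (simp_all add: divide_strict_left_mono)
  fix \<beta> :: real assume \<beta>: "0 < \<beta>" "2 * (1 - ln 2) / t < \<beta>" "\<beta> < 2 * (1 - ln 2) / s"
  then have ts: "Y < \<beta> * t" "\<beta> * s < Y"
    using st by (simp_all add: Y_def field_simps)
  \<comment> \<open>The midpoint of \<open>-Y\<close> and \<open>- (\<beta> * s)\<close>, strictly
    above \<open>dominant_real (-1)\<close>; hence the preimage found is not -1 itself.\<close>
  define \<tau> where "\<tau> = - (Y + \<beta> * s) / 2"
  have \<tau>: "- Y < \<tau>" "\<tau> < - (\<beta> * s)" using ts by (simp_all add: \<tau>_def field_simps)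
  have "\<exists>x\<ge>-1. x \<le> 0 \<and> dominant_real x = \<tau>"
  proof (rule IVT')
    show "dominant_real (- 1) \<le> \<tau>" "\<tau> \<le> dominant_real 0"
      using \<tau> mult_pos_pos[OF \<beta>(1) st(1)] by (simp_all add: dominant_real_minus_1 Y_def)
    show "continuous_on {-1..0} dominant_real"
      by (rule continuous_on_subset[OF continuous_on_dominant_real]) auto
  qed simp
  then obtain x where x: "-1 \<le> x" "x \<le> 0" "dominant_real x = \<tau>" by auto
  have "x \<noteq> -1" using x \<tau> by (auto simp: dominant_real_minus_1 Y_def)
  then have "x \<in> {-1<..<1}" using x by auto
  moreover have "1 - t < 1 + \<tau> / \<beta>" "1 + \<tau> / \<beta> < 1 - s"
    using \<tau> ts \<beta>(1) by (simp_all add: field_simps)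
  ultimately show "\<exists>x\<in>{-1<..<1}. \<forall>w\<in>\<D>. \<phi> w \<noteq> of_real (1 + dominant_real x / \<beta>)"
    using omit x(3) by blast
qed

lemma dominant_real_1_pos: "dominant_real 1 > 0"
  using dominant_real_1_lower_bound sqrt_two_bounds by simp

text \<open>The mirror image at the endpoint 1. The omitted values form a whole ray, so
  \<open>c = 0\<close> serves.\<close>

lemma sharp_bound_right:
  assumes s: "0 < s"
    and omit: "\<And>v w. 1 + s < v \<Longrightarrow> w \<in> \<D> \<Longrightarrow> \<phi> w \<noteq> of_real v"
  shows "sharp_bound \<phi> (dominant_real 1 / s)"
proof (rule sharp_boundI)
  show "0 < dominant_real 1 / s" "0 < dominant_real 1 / s"
    using dominant_real_1_pos s by simp_all
  fix \<beta> :: real assume \<beta>: "0 < \<beta>" "\<beta> < dominant_real 1 / s"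
  define \<tau> where "\<tau> = (dominant_real 1 + \<beta> * s) / 2"
  have \<tau>: "\<tau> < dominant_real 1" "\<beta> * s < \<tau>" using \<beta> s by (simp_all add: \<tau>_def field_simps)
  have "\<exists>x\<ge>0. x \<le> 1 \<and> dominant_real x = \<tau>"
  proof (rule IVT')
    show "dominant_real 0 \<le> \<tau>" "\<tau> \<le> dominant_real 1"
      using \<tau> mult_pos_pos[OF \<beta>(1) s] by simp_all
  qed (use continuous_on_dominant_real_unit in simp_all)
  then obtain x where x: "0 \<le> x" "x \<le> 1" "dominant_real x = \<tau>" by auto
  have "x \<noteq> 1" using x \<tau> by auto
  then have "x \<in> {-1<..<1}" using x by auto
  moreover have "1 + s < 1 + \<tau> / \<beta>" using \<tau> \<beta>(1) by (simp add: field_simps)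
  ultimately show "\<exists>x\<in>{-1<..<1}. \<forall>w\<in>\<D>. \<phi> w \<noteq> of_real (1 + dominant_real x / \<beta>)"
    using omit x(3) by blast
qed

section \<open>Real values omitted by the targets\<close>

lemma csqrt_omits:
  assumes "sqrt 2 < v" "w \<in> \<D>"
  shows "csqrt (1 + w) \<noteq> of_real v"
proof
  assume "csqrt (1 + w) = of_real v"
  then have "1 + w = (of_real v)\<^sup>2" by (metis power2_csqrt)
  then have "norm (1 + w) = v\<^sup>2" by (simp add: norm_power)
  moreover have "norm (1 + w) < 2" using norm_triangle_ineq[of 1 w] assms by simp
  moreover have "(sqrt 2)\<^sup>2 < v\<^sup>2" using assms by (intro power_strict_mono) auto
  ultimately show False by simp
qed

text \<open>For these \<open>v\<close> the real quadratic satisfied by \<open>w\<close> has negative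
  discriminant. Its roots are conjugate, so the square of \<open>norm w\<close> is their product
  \<open>k^2 * (1 - v)\<close>, which exceeds 1.\<close>

lemma phi0_omits:
  assumes v: "1 - (3 + 2 * sqrt 2) < v" "v < 1 - (3 - 2 * sqrt 2)" and w: "w \<in> \<D>"
  shows "phi0 w \<noteq> of_real v"
proof
  define k where "k = sqrt 2 + 1"
  define a b where "a = Re w" and "b = Im w"
  have k: "k > 0" "k\<^sup>2 = 3 + 2 * sqrt 2"
    using sqrt_two_bounds by (simp_all add: k_def power2_eq_square algebra_simps)
  have ab: "a\<^sup>2 + b\<^sup>2 < 1"
    using w cmod_power2[of w] abs_square_less_1[of "norm w"] by (simp add: a_def b_def)
  have "of_real k - w \<noteq> 0" unfolding k_def using w by (intro sqrt2_plus_one_minus_nonzero) simp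
  moreover assume "phi0 w = of_real v"
  then have "w * (of_real k + w) / (of_real k * (of_real k - w)) = of_real (v - 1)"
    unfolding phi0_altdef k_def[symmetric] by (simp add: algebra_simps)
  ultimately have "w * (of_real k + w) = of_real (v - 1) * (of_real k * (of_real k - w))"
    using k by (simp add: divide_eq_eq)
  then have "Re (w * (of_real k + w)) = Re (of_real (v - 1) * (of_real k * (of_real k - w)))"
    "Im (w * (of_real k + w)) = Im (of_real (v - 1) * (of_real k * (of_real k - w)))"
    by simp_all
  then have re: "a\<^sup>2 - b\<^sup>2 + k * v * a = k\<^sup>2 * (v - 1)" and im: "b * (2 * a + k * v) = 0"
    by (simp_all add: a_def b_def power2_eq_square algebra_simps)
  have disc: "v\<^sup>2 + 4 * (v - 1) < 0"
  proof -
    have "(v - 1 + (3 + 2 * sqrt 2)) * (v - 1 + (3 - 2 * sqrt 2)) < 0"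
      using v by (intro mult_pos_neg) auto
    moreover have "(v - 1 + (3 + 2 * sqrt 2)) * (v - 1 + (3 - 2 * sqrt 2)) = v\<^sup>2 + 4 * (v - 1)"
      by (simp add: power2_eq_square algebra_simps)
    ultimately show ?thesis by simp
  qed
  show False
  proof (cases "b = 0")
    case True
    have "(2 * a + k * v)\<^sup>2 = k\<^sup>2 * (v\<^sup>2 + 4 * (v - 1))"
      using re True by (simp add: power2_eq_square algebra_simps)
    moreover have "k\<^sup>2 * (v\<^sup>2 + 4 * (v - 1)) < 0" using disc k(1) by (intro mult_pos_neg) auto
    ultimately show False using zero_le_power2[of "2 * a + k * v"] by linarith
  next
    case False
    then have "k * v = - 2 * a" using im by simp
    then have "a\<^sup>2 + b\<^sup>2 = k\<^sup>2 * (1 - v)"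
      using re by (simp add: power2_eq_square algebra_simps)
    moreover have "k\<^sup>2 * (3 - 2 * sqrt 2) < k\<^sup>2 * (1 - v)"
      using v k(1) by (intro mult_strict_left_mono) auto
    moreover have "k\<^sup>2 * (3 - 2 * sqrt 2) = 1" unfolding k(2) by (simp add: algebra_simps)
    ultimately show False using ab by linarith
  qed
qed

text \<open>\<open>Im (sin w)\<close> is \<open>cos a * sinh b\<close> with \<open>cos a > 0\<close>
  on the disc, so a real value forces \<open>w\<close> real; then the sine is monotone.\<close>

lemma one_plus_sin_omits:
  assumes v: "v < 1 - sin 1" and w: "w \<in> \<D>"
  shows "1 + sin w \<noteq> of_real v"
proof
  assume "1 + sin w = of_real v"
  then have eq: "sin w = of_real (v - 1)" by (simp add: algebra_simps)
  define a b where "a = Re w" and "b = Im w"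
  have a: "\<bar>a\<bar> < 1" using w abs_Re_le_cmod[of w] by (simp add: a_def)
  then have c: "cos a > 0" using pi_gt3 by (intro cos_gt_zero_pi) auto
  have "Im (sin w) = 0" using eq by simp
  then have "exp b = exp (- b)" using c by (simp add: Im_sin a_def b_def)
  then have "b = 0" by simp
  then have "w = of_real a" by (simp add: a_def b_def complex_eq_iff)
  then have "of_real (sin a) = (of_real (v - 1) :: complex)" using eq by (simp add: sin_of_real)
  then have "sin a = v - 1" by (simp only: of_real_eq_iff)
  moreover have "sin (-1) < sin a"
    using a pi_gt3 by (intro sin_monotone_2pi) auto
  ultimately show False using v by simp
qed

text \<open>The equation forces \<open>2 * v * w = v^2 - 1\<close>, and \<open>norm w < 1\<close>
  then gives \<open>(v + 1)^2 > 2\<close>.\<close>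

lemma crescent_omits:
  assumes v: "0 < v" "v < sqrt 2 - 1" and w: "w \<in> \<D>"
  shows "w + csqrt (1 + w\<^sup>2) \<noteq> of_real v"
proof
  assume "w + csqrt (1 + w\<^sup>2) = of_real v"
  then have "csqrt (1 + w\<^sup>2) = of_real v - w" by (simp add: algebra_simps)
  then have "1 + w\<^sup>2 = (of_real v - w)\<^sup>2" by (metis power2_csqrt)
  then have "2 * of_real v * w = of_real (v\<^sup>2 - 1)"
    by (simp add: power2_eq_square algebra_simps)
  from arg_cong[OF this, of norm] have "2 * v * norm w = \<bar>v\<^sup>2 - 1\<bar>"
    using v unfolding norm_of_real by (simp add: norm_mult)
  moreover have "2 * v * norm w < 2 * v * 1" using v w by (intro mult_strict_left_mono) auto
  moreover have "(v + 1)\<^sup>2 < (sqrt 2)\<^sup>2" using v by (intro power_strict_mono) auto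
  ultimately show False by (simp add: power2_eq_square algebra_simps abs_if split: if_splits)
qed

text \<open>\<open>2 * (w + 1)^2 = 3 * v - 1\<close> is real and \<open>Re (w + 1) > 0\<close>, so
  \<open>w\<close> is real and \<open>3 * v - 1\<close> cannot be negative.\<close>

lemma quadratic_omits:
  assumes v: "v < 1 / 3" and w: "w \<in> \<D>"
  shows "1 + 4 / 3 * w + 2 / 3 * w\<^sup>2 \<noteq> of_real v"
proof
  assume "1 + 4 / 3 * w + 2 / 3 * w\<^sup>2 = of_real v"
  then have "3 + 4 * w + 2 * w\<^sup>2 = of_real (3 * v)" by (simp add: field_simps)
  then have "2 * (w + 1)\<^sup>2 = of_real (3 * v - 1)"
    by (simp add: power2_eq_square algebra_simps)
  moreover define x y where "x = Re w + 1" and "y = Im w"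
  ultimately have "2 * (x * x - y * y) = 3 * v - 1" "x * y = 0"
    by (auto simp: complex_eq_iff power2_eq_square)
  moreover have "x > 0" using w abs_Re_le_cmod[of w] by (simp add: x_def)
  ultimately have "2 * (x * x) = 3 * v - 1" by simp
  then show False using v zero_le_square[of x] by linarith
qed

text \<open>Solving for \<open>w\<close> gives
  \<open>\<bar>v - 1\<bar> \<le> \<bar>A - B * v\<bar>\<close>. The difference of the squares splits
  into two linear factors, which have the same strict sign for such \<open>v\<close>.\<close>

lemma mobius_omits:
  fixes A B v :: real
  assumes AB: "-1 < B" "B < A" "A < 1" and w: "w \<in> \<D>"
    and v: "v < 1 - (A - B) / (1 - B) \<or> 1 + (A - B) / (1 + B) < v"
  shows "(1 + of_real A * w) / (1 + of_real B * w) \<noteq> of_real v"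
proof
  assume eq: "(1 + of_real A * w) / (1 + of_real B * w) = of_real v"
  have "1 + of_real B * w \<noteq> 0"
  proof
    assume "1 + of_real B * w = 0"
    then have "norm (of_real B * w) = 1" by (metis add_eq_0_iff norm_minus_cancel norm_one)
    moreover have "\<bar>B\<bar> * norm w \<le> 1 * norm w" using AB by (intro mult_right_mono) auto
    ultimately show False using w by (simp add: norm_mult)
  qed
  then have "1 + of_real A * w = of_real v * (1 + of_real B * w)"
    using eq by (simp add: divide_eq_eq)
  then have "of_real (A - B * v) * w = of_real (v - 1)"
    by (simp add: algebra_simps)
  from arg_cong[OF this, of norm] have n: "\<bar>A - B * v\<bar> * norm w = \<bar>v - 1\<bar>"
    by (simp only: norm_mult norm_of_real)
  have "\<bar>A - B * v\<bar> * norm w \<le> \<bar>A - B * v\<bar> * 1"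
    using w by (intro mult_left_mono) auto
  then have "\<bar>v - 1\<bar> \<le> \<bar>A - B * v\<bar>" by (simp only: n mult_1_right)
  then have "(v - 1)\<^sup>2 \<le> (A - B * v)\<^sup>2" by (simp add: abs_le_square_iff)
  then have le: "((1 + B) * (v - 1) - (A - B)) * ((1 - B) * (v - 1) + (A - B)) \<le> 0"
    by (simp add: power2_eq_square algebra_simps)
  from v show False
  proof
    assume "v < 1 - (A - B) / (1 - B)"
    then have 1: "(1 - B) * (v - 1) + (A - B) < 0" using AB by (simp add: field_simps)
    then have "(1 - B) * (v - 1) < 0" using AB by linarith
    then have "v - 1 < 0" using AB by (simp add: mult_less_0_iff)
    then have "(1 + B) * (v - 1) < 0" using AB by (intro mult_pos_neg) auto
    then have "(1 + B) * (v - 1) - (A - B) < 0" using AB by linarith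
    from mult_neg_neg[OF this 1] show False using le by linarith
  next
    assume "1 + (A - B) / (1 + B) < v"
    then have 1: "0 < (1 + B) * (v - 1) - (A - B)" using AB by (simp add: field_simps)
    then have "0 < (1 + B) * (v - 1)" using AB by linarith
    then have "0 < v - 1" using AB by (simp add: zero_less_mult_iff)
    then have "0 < (1 - B) * (v - 1)" using AB by (intro mult_pos_pos) auto
    then have "0 < (1 - B) * (v - 1) + (A - B)" using AB by linarith
    from mult_pos_pos[OF 1 this] show False using le by linarith
  qed
qed

section \<open>The threshold \<open>B0\<close> and the assembly of the theorem\<close>

lemma B0_altdef: "B0 = (2 * (1 - ln 2) - dominant_real 1) / (2 * (1 - ln 2) + dominant_real 1)"
proof -
  have "ln 4 = 2 * ln (2::real)" using ln_realpow[of 2 2] by simp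
  then have "2 * (1 - ln 2) - dominant_real 1 = 2 * (2 - ln 4 - sqrt 2 + ln (1 + sqrt 2))"
    "2 * (1 - ln 2) + dominant_real 1 = 2 * (sqrt 2 - ln (1 + sqrt 2))"
    by (simp_all add: dominant_real_1)
  then show ?thesis unfolding B0_def by (simp only: mult_divide_mult_cancel_left)
qed

text \<open>\<open>B0\<close> is the value of \<open>B\<close> at which the two thresholds of (f)
  coincide. On either side of it the prescribed threshold is the larger one, so both conditions of
  \<open>subordinate_mobius\<close> hold.\<close>

lemma B0_less_iff:
  shows "B < B0 \<longleftrightarrow> (1 + B) * dominant_real 1 < (1 - B) * (2 * (1 - ln 2))"
    and "B0 < B \<longleftrightarrow> (1 - B) * (2 * (1 - ln 2)) < (1 + B) * dominant_real 1"
proof -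
  have "0 < 2 * (1 - ln (2::real))" using ln_2_less_1 by simp
  then have "0 < 2 * (1 - ln 2) + dominant_real 1" using dominant_real_1_pos by linarith
  then show "B < B0 \<longleftrightarrow> (1 + B) * dominant_real 1 < (1 - B) * (2 * (1 - ln 2))"
    "B0 < B \<longleftrightarrow> (1 - B) * (2 * (1 - ln 2)) < (1 + B) * dominant_real 1"
    unfolding B0_altdef by (simp_all add: pos_less_divide_eq pos_divide_less_eq algebra_simps)
qed

lemma subordinate_mobius_B0:
  assumes p: "p \<in> subord_class \<beta>" and AB: "-1 < B" "B < A" "A < 1"
    and \<beta>: "B < B0 \<and> \<beta> \<ge> 2 * (1 - B) * (1 - ln 2) / (A - B) \<or>
      B > B0 \<and> \<beta> \<ge> 2 * (1 + B) * (sqrt 2 - 1 + ln 2 - ln (1 + sqrt 2)) / (A - B)"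
  shows "p \<prec>\<^sub>\<D> (\<lambda>z. (1 + of_real A * z) / (1 + of_real B * z))"
proof (rule subordinate_mobius[OF p AB])
  have eqs: "2 * (1 + B) * (sqrt 2 - 1 + ln 2 - ln (1 + sqrt 2)) = (1 + B) * dominant_real 1"
    "2 * (1 - B) * (1 - ln 2) = (1 - B) * (2 * (1 - ln 2))"
    unfolding dominant_real_1 by (simp_all only: mult_ac)
  define X Y where "X = (1 + B) * dominant_real 1 / (A - B)"
    and "Y = (1 - B) * (2 * (1 - ln 2)) / (A - B)"
  have "B < B0 \<and> \<beta> \<ge> Y \<or> B > B0 \<and> \<beta> \<ge> X"
    using \<beta> unfolding eqs X_def Y_def .
  moreover have "X \<le> Y" if "B < B0"
    using that AB unfolding B0_less_iff X_def Y_def by (intro divide_right_mono) auto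
  moreover have "Y \<le> X" if "B0 < B"
    using that AB unfolding B0_less_iff X_def Y_def by (intro divide_right_mono) auto
  ultimately have "\<beta> \<ge> Y" "\<beta> \<ge> X" by fastforce+
  then show "\<beta> \<ge> 2 * (1 - B) * (1 - ln 2) / (A - B)"
    "\<beta> \<ge> (1 + B) * dominant_real 1 / (A - B)"
    by (simp_all only: eqs X_def Y_def)
qed

lemma crescent_bound: "(2 + sqrt 2) * (1 - ln 2) = 2 * (1 - ln 2) / (2 - sqrt 2)"
proof -
  have "(2 + sqrt 2) * (2 - sqrt 2) = 2" by (simp add: algebra_simps)
  moreover have "2 - sqrt 2 \<noteq> 0" using sqrt_two_bounds by simp
  ultimately show ?thesis by (simp add: eq_divide_eq mult_ac)
qed

lemma quadratic_bound: "3 * (1 - ln 2) = 2 * (1 - ln 2) / (2 / 3 :: real)"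
  by simp

theorem theorem2p1:
  shows "(\<forall>\<beta>. \<forall>p\<in>subord_class \<beta>.
       (\<beta> \<ge> 2 * (sqrt 2 - 1 + ln 2 - ln (1 + sqrt 2)) / (sqrt 2 - 1)
          \<longrightarrow> p \<prec>\<^sub>\<D> (\<lambda>z. csqrt (1 + z))) \<and>
       (\<beta> \<ge> 2 * (1 - ln 2) / (3 - 2 * sqrt 2) \<longrightarrow> p \<prec>\<^sub>\<D> phi0) \<and>
       (\<beta> \<ge> 2 * (1 - ln 2) / sin 1 \<longrightarrow> p \<prec>\<^sub>\<D> (\<lambda>z. 1 + sin z)) \<and>
       (\<beta> \<ge> (2 + sqrt 2) * (1 - ln 2) \<longrightarrow> p \<prec>\<^sub>\<D> (\<lambda>z. z + csqrt (1 + z\<^sup>2))) \<and>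
       (\<beta> \<ge> 3 * (1 - ln 2) \<longrightarrow> p \<prec>\<^sub>\<D> (\<lambda>z. 1 + 4 / 3 * z + 2 / 3 * z\<^sup>2)) \<and>
       (\<forall>A B. -1 < B \<and> B < A \<and> A < 1 \<and>
          (B < B0 \<and> \<beta> \<ge> 2 * (1 - B) * (1 - ln 2) / (A - B) \<or>
           B > B0 \<and> \<beta> \<ge> 2 * (1 + B) * (sqrt 2 - 1 + ln 2 - ln (1 + sqrt 2)) / (A - B))
          \<longrightarrow> p \<prec>\<^sub>\<D> (\<lambda>z. (1 + of_real A * z) / (1 + of_real B * z))))
   \<and> sharp_bound (\<lambda>z. csqrt (1 + z))
       (2 * (sqrt 2 - 1 + ln 2 - ln (1 + sqrt 2)) / (sqrt 2 - 1))
   \<and> sharp_bound phi0 (2 * (1 - ln 2) / (3 - 2 * sqrt 2))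
   \<and> sharp_bound (\<lambda>z. 1 + sin z) (2 * (1 - ln 2) / sin 1)
   \<and> sharp_bound (\<lambda>z. z + csqrt (1 + z\<^sup>2)) ((2 + sqrt 2) * (1 - ln 2))
   \<and> sharp_bound (\<lambda>z. 1 + 4 / 3 * z + 2 / 3 * z\<^sup>2) (3 * (1 - ln 2))
   \<and> (\<forall>A B. -1 < B \<and> B < A \<and> A < 1 \<longrightarrow>
       (B < B0 \<longrightarrow> sharp_bound (\<lambda>z. (1 + of_real A * z) / (1 + of_real B * z))
          (2 * (1 - B) * (1 - ln 2) / (A - B))) \<and>
       (B > B0 \<longrightarrow> sharp_bound (\<lambda>z. (1 + of_real A * z) / (1 + of_real B * z))
          (2 * (1 + B) * (sqrt 2 - 1 + ln 2 - ln (1 + sqrt 2)) / (A - B))))"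
proof (intro conjI allI ballI impI)
  fix \<beta> p assume p: "p \<in> subord_class \<beta>"
  have hol: "p holomorphic_on \<D>" using p by (rule subord_class_holomorphic)
  have p0: "p 0 = 1" using p by (simp add: subord_class_def)
  note bound = subord_class_norm_less[OF p]
  show "p \<prec>\<^sub>\<D> (\<lambda>z. csqrt (1 + z))"
    if "\<beta> \<ge> 2 * (sqrt 2 - 1 + ln 2 - ln (1 + sqrt 2)) / (sqrt 2 - 1)"
    using that unfolding dominant_real_1[symmetric] by (rule subordinate_csqrt[OF p])
  show "p \<prec>\<^sub>\<D> phi0" if "\<beta> \<ge> 2 * (1 - ln 2) / (3 - 2 * sqrt 2)"
    using sqrt_two_bounds that by (intro subordinate_phi0 hol p0 bound) auto
  show "p \<prec>\<^sub>\<D> (\<lambda>z. 1 + sin z)" if "\<beta> \<ge> 2 * (1 - ln 2) / sin 1"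
    using sin_one_pos that by (intro subordinate_one_plus_sin hol p0 bound) auto
  show "p \<prec>\<^sub>\<D> (\<lambda>z. z + csqrt (1 + z\<^sup>2))" if "\<beta> \<ge> (2 + sqrt 2) * (1 - ln 2)"
    using that sqrt_two_bounds unfolding crescent_bound
    by (intro subordinate_crescent hol p0 bound) auto
  show "p \<prec>\<^sub>\<D> (\<lambda>z. 1 + 4 / 3 * z + 2 / 3 * z\<^sup>2)" if "\<beta> \<ge> 3 * (1 - ln 2)"
    using that unfolding quadratic_bound by (intro subordinate_quadratic hol p0 bound) auto
  show "p \<prec>\<^sub>\<D> (\<lambda>z. (1 + of_real A * z) / (1 + of_real B * z))"
    if "-1 < B \<and> B < A \<and> A < 1 \<and>
          (B < B0 \<and> \<beta> \<ge> 2 * (1 - B) * (1 - ln 2) / (A - B) \<or>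
           B > B0 \<and> \<beta> \<ge> 2 * (1 + B) * (sqrt 2 - 1 + ln 2 - ln (1 + sqrt 2)) / (A - B))" for A B
    using that by (intro subordinate_mobius_B0[OF p]) auto
next
  show "sharp_bound (\<lambda>z. csqrt (1 + z))
      (2 * (sqrt 2 - 1 + ln 2 - ln (1 + sqrt 2)) / (sqrt 2 - 1))"
    unfolding dominant_real_1[symmetric]
    using sqrt_two_bounds csqrt_omits by (intro sharp_bound_right) auto
  show "sharp_bound phi0 (2 * (1 - ln 2) / (3 - 2 * sqrt 2))"
    by (rule sharp_bound_left[of _ "3 + 2 * sqrt 2"])
       (use sqrt_two_bounds phi0_omits in auto)
  show "sharp_bound (\<lambda>z. 1 + sin z) (2 * (1 - ln 2) / sin 1)"
    \<comment> \<open>\<open>1 + sin z\<close> omits every real value below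
      \<open>1 - sin 1\<close>, so any \<open>t > s\<close> serves.\<close>
    by (rule sharp_bound_left[of _ "sin 1 + 1"])
       (use sin_one_pos one_plus_sin_omits in auto)
  show "sharp_bound (\<lambda>z. z + csqrt (1 + z\<^sup>2)) ((2 + sqrt 2) * (1 - ln 2))"
    unfolding crescent_bound
    \<comment> \<open>\<open>t = 1\<close> confines the omitted values to \<open>v > 0\<close>, as
      \<open>crescent_omits\<close> requires.\<close>
    by (rule sharp_bound_left[of _ 1]) (use sqrt_two_bounds crescent_omits in auto)
  have "sharp_bound (\<lambda>z. 1 + 4 / 3 * z + 2 / 3 * z\<^sup>2) (2 * (1 - ln 2) / (2 / 3))"
    by (rule sharp_bound_left[of _ 1]) (use quadratic_omits in auto)
  then show "sharp_bound (\<lambda>z. 1 + 4 / 3 * z + 2 / 3 * z\<^sup>2) (3 * (1 - ln 2))"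
    unfolding quadratic_bound .
  fix A B :: real assume AB: "-1 < B \<and> B < A \<and> A < 1"
  have "sharp_bound (\<lambda>z. (1 + of_real A * z) / (1 + of_real B * z)) (2 * (1 - ln 2) / ((A - B) / (1 - B)))"
    by (rule sharp_bound_left[of _ "(A - B) / (1 - B) + 1"]) (use AB mobius_omits in auto)
  then show "sharp_bound (\<lambda>z. (1 + of_real A * z) / (1 + of_real B * z))
      (2 * (1 - B) * (1 - ln 2) / (A - B))"
    by (simp only: divide_divide_eq_right mult_ac)
  have "sharp_bound (\<lambda>z. (1 + of_real A * z) / (1 + of_real B * z)) (dominant_real 1 / ((A - B) / (1 + B)))"
    by (rule sharp_bound_right) (use AB mobius_omits in auto)
  then show "sharp_bound (\<lambda>z. (1 + of_real A * z) / (1 + of_real B * z))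
      (2 * (1 + B) * (sqrt 2 - 1 + ln 2 - ln (1 + sqrt 2)) / (A - B))"
    unfolding dominant_real_1 by (simp only: divide_divide_eq_right mult_ac)
qed

end
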